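(* Let $\gamma<\omega_1$ be an ordinal and let $X$ be an $\mathrm{F}_d$-compact of spectral height $\gamma$, with $X=\varprojlim\{X_\alpha,\pi^\beta_\alpha,\ \alpha,\beta\in\gamma\}$, where $\{X_\alpha,\pi^\beta_\alpha,\ \alpha,\beta\in\gamma\}$ is an F-decomposable system such that all fibers of all neighboring bonding mappings $\pi^{\alpha+1}_\alpha$ ($\alpha+1\in\gamma$) are metrizable. Then the Banach space $C(X)$ (with the supremum norm) admits an equivalent norm which is locally uniformly rotund and lower semicontinuous with respect to the topology $\tau_p$ of pointwise convergence on $X$.
   Context: Small image: for a mapping $f:M\to N$ and $A\subset M$, $f^\#(A):=N\setminus f(M\setminus A)$. Fully closed: a continuous mapping $f:X\to Y$ between topological spaces is fully closed at $y\in Y$ if for any finite family $U_1,\dots,U_s$ of open subsets of $X$ covering $f^{-1}(y)$ the set $\{y\}\cup\bigcup_{i=1}^s f^\#(U_i)$ is a neighborhood of $y$. A continuous surjection is fully closed if it is fully closed at every point of $Y$. (For Hausdorff compacta this is equivalent to: $f(F_1)\cap f(F_2)$ is finite for any disjoint closed $F_1,F_2\subset X$.) Systems: let $\gamma$ be an ordinal and $S=\{X_\alpha,\pi^\beta_\alpha,\ \alpha,\beta\in\gamma\}$ a well-ordered continuous inverse system of Hausdorff compacta with $X_0$ a singleton; here $\pi^\beta_\alpha:X_\beta\to X_\alpha$ for $\alpha\le\beta<\gamma$, and continuous means that for each limit ordinal $\alpha<\gamma$, $X_\alpha$ is the inverse limit of $\{X_\beta,\pi_\beta^\delta,\ \beta,\delta\in\alpha\}$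 with the $\pi^\alpha_\beta$ as canonical projections. The ordinal $\gamma$ is the length of $S$. $S$ is an F-system if all neighboring bonding mappings $\pi^{\alpha+1}_\alpha$, $\alpha+1\in\gamma$, are fully closed. $S$ is F-decomposable if all bonding mappings $\pi^\beta_\alpha$ are fully closed. Let $S$ be an F-system for which the fibers of all neighboring bonding mappings are metrizable. Then $X=\varprojlim S$ is called a Fedorchuk compact (F-compact), and the length of $S$ is called the spectral height of $X$, denoted $\mathrm{sh}(X)$, provided that $X$ cannot be obtained as the limit of a system satisfying these conditions of strictly smaller length. If $S$ is moreover F-decomposable, $X$ is called an $\mathrm{F}_d$-compact. $C(X)$ is the space of real-valued continuous functions on $X$. A norm $\|\cdot\|$ on a Banach space $E$ is locally uniformly rotund (LUR) if for any $x$ in its unit sphere $S_E$ and any sequence $(x_n)\subset S_E$, $\lim_n\|(x+x_n)/2\|=1$ implies $\lim_n\|x-x_n\|=0$. *)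

theory Defs
  imports "HOL-Analysis.Analysis"
begin

subsection \<open>Ordinals\<close>

text \<open>
  An ordinal is represented by an element \<open>\<gamma>\<close> of a type of class \<open>wellorder\<close>, standing for
  the order type of its initial segment \<open>{..<\<gamma>}\<close>; thus \<open>\<alpha> \<in> \<gamma>\<close> is written \<open>\<alpha> < \<gamma>\<close>, the ordinals
  strictly smaller than \<open>\<gamma>\<close> are the elements below \<open>\<gamma>\<close>, and \<open>\<gamma> < \<omega>\<^sub>1\<close> says that \<open>{..<\<gamma>}\<close> is
  countable. The type itself may be longer than \<open>\<gamma>\<close>.
\<close>

definition zero_ordinal :: "'i::wellorder \<Rightarrow> bool"
  where "zero_ordinal \<alpha> \<longleftrightarrow> (\<forall>\<beta>. \<alpha> \<le> \<beta>)"

definition succ_ordinal :: "'i::wellorder \<Rightarrow> 'i \<Rightarrow> bool"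
  \<comment> \<open>\<open>\<beta> = \<alpha> + 1\<close>; a relation, since \<open>\<alpha>\<close> may be the largest element of the type\<close>
  where "succ_ordinal \<alpha> \<beta> \<longleftrightarrow> \<alpha> < \<beta> \<and> (\<forall>\<delta>. \<alpha> < \<delta> \<longrightarrow> \<beta> \<le> \<delta>)"

definition limit_ordinal :: "'i::wellorder \<Rightarrow> bool"
  where "limit_ordinal \<alpha> \<longleftrightarrow> \<not> zero_ordinal \<alpha> \<and> (\<nexists>\<beta>. succ_ordinal \<beta> \<alpha>)"

subsection \<open>Fully closed mappings\<close>

definition small_image :: "'a topology \<Rightarrow> 'b topology \<Rightarrow> ('a \<Rightarrow> 'b) \<Rightarrow> 'a set \<Rightarrow> 'b set"
  where "small_image X Y f A = topspace Y - f ` (topspace X - A)"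

definition fiber :: "'a topology \<Rightarrow> ('a \<Rightarrow> 'b) \<Rightarrow> 'b \<Rightarrow> 'a set"
  where "fiber X f y = {x \<in> topspace X. f x = y}"

definition fully_closed_at :: "'a topology \<Rightarrow> 'b topology \<Rightarrow> ('a \<Rightarrow> 'b) \<Rightarrow> 'b \<Rightarrow> bool"
  where "fully_closed_at X Y f y \<longleftrightarrow>
    (\<forall>\<U>. finite \<U> \<and> (\<forall>U\<in>\<U>. openin X U) \<and> fiber X f y \<subseteq> \<Union>\<U> \<longrightarrow>
      (\<exists>V. openin Y V \<and> y \<in> V \<and> V \<subseteq> {y} \<union> (\<Union>U\<in>\<U>. small_image X Y f U)))"

definition fully_closed_map :: "'a topology \<Rightarrow> 'b topology \<Rightarrow> ('a \<Rightarrow> 'b) \<Rightarrow> bool"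
  where "fully_closed_map X Y f \<longleftrightarrow>
    continuous_map X Y f \<and> f ` topspace X = topspace Y \<and>
    (\<forall>y\<in>topspace Y. fully_closed_at X Y f y)"

subsection \<open>Well-ordered inverse systems\<close>

text \<open>
  In a system of length \<open>\<gamma>\<close>, \<open>\<pi> \<alpha> \<beta>\<close> is the bonding mapping from \<open>X \<beta>\<close> to \<open>X \<alpha>\<close>, for
  \<open>\<alpha> \<le> \<beta> < \<gamma>\<close>. Values of \<open>X\<close> and \<open>\<pi>\<close> at indices not below \<open>\<gamma>\<close> are irrelevant.
\<close>

definition inverse_limit ::
    "'i::wellorder \<Rightarrow> ('i \<Rightarrow> 'a topology) \<Rightarrow> ('i \<Rightarrow> 'i \<Rightarrow> 'a \<Rightarrow> 'a) \<Rightarrow> ('i \<Rightarrow> 'a) topology"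
  where "inverse_limit \<gamma> X \<pi> =
    subtopology (product_topology X {..<\<gamma>})
      {x. \<forall>\<alpha> \<beta>. \<alpha> \<le> \<beta> \<and> \<beta> < \<gamma> \<longrightarrow> \<pi> \<alpha> \<beta> (x \<beta>) = x \<alpha>}"

definition inverse_system ::
    "'i::wellorder \<Rightarrow> ('i \<Rightarrow> 'a topology) \<Rightarrow> ('i \<Rightarrow> 'i \<Rightarrow> 'a \<Rightarrow> 'a) \<Rightarrow> bool"
  where "inverse_system \<gamma> X \<pi> \<longleftrightarrow>
    (\<forall>\<alpha> \<beta>. \<alpha> \<le> \<beta> \<and> \<beta> < \<gamma> \<longrightarrow> continuous_map (X \<beta>) (X \<alpha>) (\<pi> \<alpha> \<beta>)) \<and>
    (\<forall>\<alpha> x. \<alpha> < \<gamma> \<and> x \<in> topspace (X \<alpha>) \<longrightarrow> \<pi> \<alpha> \<alpha> x = x) \<and>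
    (\<forall>\<alpha> \<beta> \<delta> x. \<alpha> \<le> \<beta> \<and> \<beta> \<le> \<delta> \<and> \<delta> < \<gamma> \<and> x \<in> topspace (X \<delta>) \<longrightarrow>
      \<pi> \<alpha> \<beta> (\<pi> \<beta> \<delta> x) = \<pi> \<alpha> \<delta> x)"

definition continuous_system ::
    "'i::wellorder \<Rightarrow> ('i \<Rightarrow> 'a topology) \<Rightarrow> ('i \<Rightarrow> 'i \<Rightarrow> 'a \<Rightarrow> 'a) \<Rightarrow> bool"
  where "continuous_system \<gamma> X \<pi> \<longleftrightarrow>
    (\<forall>\<alpha><\<gamma>. limit_ordinal \<alpha> \<longrightarrow>
      homeomorphic_map (X \<alpha>) (inverse_limit \<alpha> X \<pi>) (\<lambda>x. \<lambda>\<beta>\<in>{..<\<alpha>}. \<pi> \<beta> \<alpha> x))"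

text \<open>
  The requirement that \<open>X\<^sub>0\<close> be a singleton includes that \<open>X\<^sub>0\<close> exists, that is, \<open>\<gamma> > 0\<close>.
\<close>

definition standard_system ::
    "'i::wellorder \<Rightarrow> ('i \<Rightarrow> 'a topology) \<Rightarrow> ('i \<Rightarrow> 'i \<Rightarrow> 'a \<Rightarrow> 'a) \<Rightarrow> bool"
  where "standard_system \<gamma> X \<pi> \<longleftrightarrow>
    inverse_system \<gamma> X \<pi> \<and> continuous_system \<gamma> X \<pi> \<and>
    (\<forall>\<alpha><\<gamma>. compact_space (X \<alpha>) \<and> Hausdorff_space (X \<alpha>)) \<and>
    (\<exists>\<alpha><\<gamma>. zero_ordinal \<alpha> \<and> (\<exists>a. topspace (X \<alpha>) = {a}))"

definition F_system ::
    "'i::wellorder \<Rightarrow> ('i \<Rightarrow> 'a topology) \<Rightarrow> ('i \<Rightarrow> 'i \<Rightarrow> 'a \<Rightarrow> 'a) \<Rightarrow> bool"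
  where "F_system \<gamma> X \<pi> \<longleftrightarrow>
    standard_system \<gamma> X \<pi> \<and>
    (\<forall>\<alpha> \<beta>. succ_ordinal \<alpha> \<beta> \<and> \<beta> < \<gamma> \<longrightarrow> fully_closed_map (X \<beta>) (X \<alpha>) (\<pi> \<alpha> \<beta>))"

definition F_decomposable ::
    "'i::wellorder \<Rightarrow> ('i \<Rightarrow> 'a topology) \<Rightarrow> ('i \<Rightarrow> 'i \<Rightarrow> 'a \<Rightarrow> 'a) \<Rightarrow> bool"
  where "F_decomposable \<gamma> X \<pi> \<longleftrightarrow>
    standard_system \<gamma> X \<pi> \<and>
    (\<forall>\<alpha> \<beta>. \<alpha> \<le> \<beta> \<and> \<beta> < \<gamma> \<longrightarrow> fully_closed_map (X \<beta>) (X \<alpha>) (\<pi> \<alpha> \<beta>))"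

definition metrizable_neighboring_fibers ::
    "'i::wellorder \<Rightarrow> ('i \<Rightarrow> 'a topology) \<Rightarrow> ('i \<Rightarrow> 'i \<Rightarrow> 'a \<Rightarrow> 'a) \<Rightarrow> bool"
  where "metrizable_neighboring_fibers \<gamma> X \<pi> \<longleftrightarrow>
    (\<forall>\<alpha> \<beta>. succ_ordinal \<alpha> \<beta> \<and> \<beta> < \<gamma> \<longrightarrow>
      (\<forall>y\<in>topspace (X \<alpha>). metrizable_space (subtopology (X \<beta>) (fiber (X \<beta>) (\<pi> \<alpha> \<beta>) y))))"

subsection \<open>Spectral height\<close>

text \<open>
  The systems considered here have their spaces on subsets of the type \<open>'x\<close> carrying the limit
  \<open>Z\<close>. This is no loss of generality: neighboring bonding mappings of an F-system are surjective,
  hence by continuity so are all projections from the limit, and every \<open>X \<alpha>\<close> can be transported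
  to a set of representatives in \<open>'x\<close>.
\<close>

definition F_compact_of_length :: "'x topology \<Rightarrow> 'i::wellorder \<Rightarrow> bool"
  where "F_compact_of_length Z \<gamma> \<longleftrightarrow>
    (\<exists>(X :: 'i \<Rightarrow> 'x topology) \<pi>.
      F_system \<gamma> X \<pi> \<and> metrizable_neighboring_fibers \<gamma> X \<pi> \<and>
      Z homeomorphic_space inverse_limit \<gamma> X \<pi>)"

definition has_spectral_height :: "'x topology \<Rightarrow> 'i::wellorder \<Rightarrow> bool"
  where "has_spectral_height Z \<gamma> \<longleftrightarrow>
    F_compact_of_length Z \<gamma> \<and> (\<forall>\<delta><\<gamma>. \<not> F_compact_of_length Z \<delta>)"

subsection \<open>Norms\<close>

definition equivalent_norm :: "('e::real_normed_vector \<Rightarrow> real) \<Rightarrow> bool"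
  where "equivalent_norm N \<longleftrightarrow>
    (\<forall>x. N x = 0 \<longleftrightarrow> x = 0) \<and>
    (\<forall>a x. N (a *\<^sub>R x) = \<bar>a\<bar> * N x) \<and>
    (\<forall>x y. N (x + y) \<le> N x + N y) \<and>
    (\<exists>c>0. \<exists>C>0. \<forall>x. c * norm x \<le> N x \<and> N x \<le> C * norm x)"

definition LUR_norm :: "('e::real_vector \<Rightarrow> real) \<Rightarrow> bool"
  where "LUR_norm N \<longleftrightarrow>
    (\<forall>x xs. N x = 1 \<and> (\<forall>n::nat. N (xs n) = 1) \<and>
        (\<lambda>n. N ((1/2) *\<^sub>R (x + xs n))) \<longlonglongrightarrow> 1 \<longrightarrow>
      (\<lambda>n. N (x - xs n)) \<longlonglongrightarrow> 0)"

definition lower_semicontinuous_map :: "'a topology \<Rightarrow> ('a \<Rightarrow> real) \<Rightarrow> bool"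
  where "lower_semicontinuous_map T f \<longleftrightarrow> (\<forall>c. openin T {x \<in> topspace T. c < f x})"

text \<open>
  For compact \<open>'x\<close> the type \<open>'x \<Rightarrow>\<^sub>C real\<close> consists of all continuous real functions, with the
  supremum norm, so it is the Banach space \<open>C(X)\<close>.
\<close>

definition pointwise_topology :: "('x::topological_space \<Rightarrow>\<^sub>C real) topology"
  where "pointwise_topology =
    pullback_topology UNIV apply_bcontfun (product_topology (\<lambda>_. euclideanreal) UNIV)"

end

theory Submission
  imports Defs
begin

text \<open>
  For a level \<open>\<alpha>\<close> consider the functions \<open>f\<close> on \<open>X\<close> that oscillate by less than \<open>\<epsilon>\<close> on every
  fiber of the projection to level \<open>\<alpha>\<close>. By transfinite induction on \<open>\<alpha>\<close> there are countably many
  convex, pointwise lower semicontinuous functions on \<open>C(X)\<close> that satisfy the condition of local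
  uniform rotundity at these \<open>f\<close> up to an error \<open>4 \<epsilon>\<close>. At level 0 such \<open>f\<close> are nearly constant;
  at a limit level compactness shows that \<open>f\<close> already belongs to an earlier level, and there are only
  countably many of these. At a successor level, full closedness leaves finitely many points of the
  previous level over which \<open>f\<close> oscillates by at least \<open>\<epsilon>\<close>; convexity pins these points down, and
  as the fibers over them are metrizable, subtracting one of countably many functions leads back to
  the previous level. By compactness every \<open>f\<close> occurs at some level below \<open>\<gamma>\<close>, and
  the gauge of a sublevel set of a weighted sum of all these convex functions is the norm.
\<close>

subsection \<open>Pointwise lower semicontinuity\<close>

text \<open>The finite set over which \<open>f\<close> oscillates much varies with \<open>f\<close>
  among possibly uncountably many sets, so no countable family can devote a function to each of
  them. A supremum over all sets of bounded size absorbs this freedom: only the size and the index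
  of a corrector in an enumeration remain as parameters. Correctors act by translation, which
  destroys homogeneity and symmetry. This is why the induction handles convex functions and a norm
  appears only at the end. Translating \<open>f\<close> and the sequence by the same corrector keeps
  their distances, so the successor step preserves the error. The error arises at level 0 alone:
  \<open>f\<close> lies within 2 \<epsilon> of a rational constant, and a sequence asymptotically
  equally far from that constant is within 4 \<epsilon> of \<open>f\<close>. Functions live on the
  limit and not on the next level, so finiteness over level \<alpha> is drawn from bonding mappings
  that start at levels possibly far above \<alpha>; here F-decomposability enters.\<close>

definition pointwise_lsc :: "(('x::topological_space \<Rightarrow>\<^sub>C real) \<Rightarrow> real) \<Rightarrow> bool"
  where "pointwise_lsc G \<longleftrightarrow>
    (\<forall>f c. c < G f \<longrightarrow>
      (\<exists>P e. finite P \<and> 0 < e \<and> (\<forall>g. (\<forall>x\<in>P. \<bar>apply_bcontfun g x - apply_bcontfun f x\<bar> < e) \<longrightarrow> c < G g)))"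

lemma pointwise_lscD:
  assumes "pointwise_lsc G" "c < G f"
  obtains P e where "finite P" "0 < e" "\<And>g. (\<And>x. x \<in> P \<Longrightarrow> \<bar>apply_bcontfun g x - apply_bcontfun f x\<bar> < e) \<Longrightarrow> c < G g"
  using assms unfolding pointwise_lsc_def by metis

lemma lower_semicontinuous_map_pointwise:
  fixes G :: "('x::topological_space \<Rightarrow>\<^sub>C real) \<Rightarrow> real"
  assumes "pointwise_lsc G"
  shows "lower_semicontinuous_map pointwise_topology G"
  unfolding lower_semicontinuous_map_def
proof
  fix c
  have top: "topspace pointwise_topology = (UNIV :: ('x \<Rightarrow>\<^sub>C real) set)"
    by (simp add: pointwise_topology_def topspace_pullback_topology)
  show "openin pointwise_topology {f \<in> topspace pointwise_topology. c < G f}"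
  proof (subst openin_subopen, intro ballI)
    fix f assume "f \<in> {f \<in> topspace pointwise_topology. c < G f}"
    then have "c < G f" by simp
    with assms obtain P e where Pe: "finite P" "0 < e"
      "\<And>g. (\<And>x. x \<in> P \<Longrightarrow> \<bar>apply_bcontfun g x - apply_bcontfun f x\<bar> < e) \<Longrightarrow> c < G g"
      by (rule pointwise_lscD) blast
    define V where "V = Pi\<^sub>E UNIV (\<lambda>x. if x \<in> P then ball (f x) e else UNIV)"
    have "openin (product_topology (\<lambda>_. euclideanreal) UNIV) V"
      unfolding V_def using Pe(1)
      by (intro product_topology_basis) (auto intro: finite_subset[of _ P] split: if_splits)
    then have "openin pointwise_topology (apply_bcontfun -` V \<inter> UNIV)"
      unfolding pointwise_topology_def openin_pullback_topology by blast
    moreover have "f \<in> apply_bcontfun -` V \<inter> UNIV"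
      using Pe(2) by (auto simp: V_def PiE_def)
    moreover have "apply_bcontfun -` V \<inter> UNIV \<subseteq> {f \<in> topspace pointwise_topology. c < G f}"
    proof
      fix g assume "g \<in> apply_bcontfun -` V \<inter> UNIV"
      then have *: "apply_bcontfun g x \<in> (if x \<in> P then ball (f x) e else UNIV)" for x
        by (simp add: V_def PiE_def Pi_def)
      have "\<bar>apply_bcontfun g x - apply_bcontfun f x\<bar> < e" if "x \<in> P" for x
        using *[of x] that by (simp add: dist_real_def abs_minus_commute)
      then show "g \<in> {f \<in> topspace pointwise_topology. c < G f}"
        using Pe(3) top by simp
    qed
    ultimately show "\<exists>T. openin pointwise_topology T \<and> f \<in> T \<and>
        T \<subseteq> {f \<in> topspace pointwise_topology. c < G f}" by blast
  qed
qed

lemma pointwise_lsc_add: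
  assumes F: "pointwise_lsc F" and G: "pointwise_lsc G"
  shows "pointwise_lsc (\<lambda>f. F f + G f)"
  unfolding pointwise_lsc_def
proof (intro allI impI)
  fix f c assume c: "c < F f + G f"
  define d where "d = (F f + G f - c) / 2"
  have "F f - d < F f" "G f - d < G f" using c by (auto simp: d_def)
  then obtain P e Q e' where "finite P" "0 < e" and
    P: "\<And>g. (\<And>x. x \<in> P \<Longrightarrow> \<bar>apply_bcontfun g x - apply_bcontfun f x\<bar> < e) \<Longrightarrow> F f - d < F g" and
    "finite Q" "0 < e'" and
    Q: "\<And>g. (\<And>x. x \<in> Q \<Longrightarrow> \<bar>apply_bcontfun g x - apply_bcontfun f x\<bar> < e') \<Longrightarrow> G f - d < G g"
    by (metis pointwise_lscD[OF F] pointwise_lscD[OF G])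
  then show "\<exists>P e. finite P \<and> 0 < e \<and> (\<forall>g. (\<forall>x\<in>P. \<bar>apply_bcontfun g x - apply_bcontfun f x\<bar> < e) \<longrightarrow> c < F g + G g)"
  proof (intro exI[of _ "P \<union> Q"] exI[of _ "min e e'"] conjI allI impI)
    fix g :: "'a \<Rightarrow>\<^sub>C real" assume "\<forall>x\<in>P \<union> Q. \<bar>apply_bcontfun g x - apply_bcontfun f x\<bar> < min e e'"
    then have "F f - d < F g" "G f - d < G g" by (auto intro: P Q)
    then show "c < F g + G g" unfolding d_def by argo
  qed auto
qed

lemma pointwise_lsc_SUP:
  assumes "I \<noteq> {}" "\<And>i. i \<in> I \<Longrightarrow> pointwise_lsc (G i)" "\<And>f. bdd_above ((\<lambda>i. G i f) ` I)"
  shows "pointwise_lsc (\<lambda>f. SUP i\<in>I. G i f)"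
  unfolding pointwise_lsc_def
proof (intro allI impI)
  fix f c assume "c < (SUP i\<in>I. G i f)"
  then obtain i where i: "i \<in> I" "c < G i f"
    using assms by (auto simp: less_cSUP_iff)
  from assms(2)[OF i(1)] i(2) obtain P e where Pe: "finite P" "0 < e"
    "\<And>g. (\<And>x. x \<in> P \<Longrightarrow> \<bar>apply_bcontfun g x - apply_bcontfun f x\<bar> < e) \<Longrightarrow> c < G i g"
    by (rule pointwise_lscD) blast
  show "\<exists>P e. finite P \<and> 0 < e \<and> (\<forall>g. (\<forall>x\<in>P. \<bar>apply_bcontfun g x - apply_bcontfun f x\<bar> < e) \<longrightarrow> c < (SUP i\<in>I. G i g))"
  proof (intro exI[of _ P] exI[of _ e] conjI allI impI)
    fix g assume "\<forall>x\<in>P. \<bar>apply_bcontfun g x - apply_bcontfun f x\<bar> < e"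
    then have "c < G i g" using Pe(3) by simp
    also have "\<dots> \<le> (SUP i\<in>I. G i g)" using i(1) assms(3) by (rule cSUP_upper)
    finally show "c < (SUP i\<in>I. G i g)" .
  qed (use Pe in auto)
qed

lemma pointwise_lsc_const: "pointwise_lsc (\<lambda>f. c)"
  unfolding pointwise_lsc_def by (intro allI impI exI[of _ "{}"] exI[of _ 1]) auto

text \<open>At \<open>G f = 0\<close> no threshold strictly below \<open>G f\<close> lies in the
  half-line where \<open>h\<close> is monotone, so this case is separate: \<open>h 0\<close> is the
  least value of \<open>h\<close> there, and every \<open>g\<close> qualifies.\<close>

lemma pointwise_lsc_compose:
  assumes G: "pointwise_lsc G" and h: "mono_on {0..} h" "continuous_on {0..} h" and nn: "\<And>f. 0 \<le> G f"
  shows "pointwise_lsc (\<lambda>f. h (G f) :: real)"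
  unfolding pointwise_lsc_def
proof (intro allI impI)
  fix f c assume c: "c < h (G f)"
  show "\<exists>P e. finite P \<and> 0 < e \<and> (\<forall>g. (\<forall>x\<in>P. \<bar>apply_bcontfun g x - apply_bcontfun f x\<bar> < e) \<longrightarrow> c < h (G g))"
  proof (cases "G f = 0")
    case True
    then have "c < h (G g)" for g
      using c monotone_onD[OF h(1), of 0 "G g"] nn[of g] by auto
    then show ?thesis by (intro exI[of _ "{}"] exI[of _ 1]) auto
  next
    case False
    have "\<forall>\<^sub>F s in at (G f) within {0..}. c < h s"
      using h(2) nn[of f] c unfolding continuous_on_def by (auto intro: order_tendstoD)
    then obtain d where d: "d > 0" "\<And>s. s \<ge> 0 \<Longrightarrow> \<bar>s - G f\<bar> < d \<Longrightarrow> c < h s"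
      using c unfolding eventually_at by (metis atLeast_iff dist_real_def abs_0)
    \<comment> \<open>The first entry keeps \<open>s\<close> nonnegative, the second keeps it within
      \<open>d\<close> of \<open>G f\<close>; both lie strictly below \<open>G f\<close>.\<close>
    define s where "s = max (G f / 2) (G f - d / 2)"
    have Gf: "0 < G f" using False nn[of f] by simp
    then have s: "0 \<le> s" "s < G f" "c < h s" using d by (auto simp: s_def intro!: d(2))
    from G s(2) obtain P e where Pe: "finite P" "0 < e"
      "\<And>g. (\<And>x. x \<in> P \<Longrightarrow> \<bar>apply_bcontfun g x - apply_bcontfun f x\<bar> < e) \<Longrightarrow> s < G g" by (rule pointwise_lscD) blast
    have "c < h (G g)" if "\<forall>x\<in>P. \<bar>apply_bcontfun g x - apply_bcontfun f x\<bar> < e" for g :: "'a \<Rightarrow>\<^sub>C real"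
    proof -
      have "s < G g" using Pe(3) that by blast
      then have "h s \<le> h (G g)" using monotone_onD[OF h(1), of s "G g"] s nn[of g] by simp
      then show ?thesis using s by simp
    qed
    then show ?thesis using Pe by blast
  qed
qed

lemma pointwise_lsc_affine:
  assumes G: "pointwise_lsc G"
  shows "pointwise_lsc (\<lambda>f. G (a *\<^sub>R f + u))"
  unfolding pointwise_lsc_def
proof (intro allI impI)
  fix f c assume "c < G (a *\<^sub>R f + u)"
  with G obtain P e where Pe: "finite P" "0 < e"
    "\<And>g. (\<And>x. x \<in> P \<Longrightarrow> \<bar>apply_bcontfun g x - apply_bcontfun (a *\<^sub>R f + u) x\<bar> < e) \<Longrightarrow> c < G g"
    by (rule pointwise_lscD) blast
  \<comment> \<open>The denominator \<open>\<bar>a\<bar> + 1\<close> also covers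
    \<open>a = 0\<close>.\<close>
  have "c < G (a *\<^sub>R g + u)" if g: "\<forall>x\<in>P. \<bar>apply_bcontfun g x - apply_bcontfun f x\<bar> < e / (\<bar>a\<bar> + 1)" for g :: "'a \<Rightarrow>\<^sub>C real"
  proof (rule Pe(3))
    fix x assume "x \<in> P"
    then have *: "\<bar>apply_bcontfun g x - apply_bcontfun f x\<bar> * (\<bar>a\<bar> + 1) < e" using g by (simp add: field_simps)
    have "\<bar>(a *\<^sub>R g + u) x - (a *\<^sub>R f + u) x\<bar> = \<bar>apply_bcontfun g x - apply_bcontfun f x\<bar> * \<bar>a\<bar>"
      by (simp add: abs_mult[symmetric] algebra_simps)
    also have "\<dots> \<le> \<bar>apply_bcontfun g x - apply_bcontfun f x\<bar> * (\<bar>a\<bar> + 1)" by (intro mult_left_mono) auto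
    finally show "\<bar>(a *\<^sub>R g + u) x - (a *\<^sub>R f + u) x\<bar> < e" using * by simp
  qed
  then show "\<exists>P e. finite P \<and> 0 < e \<and> (\<forall>g. (\<forall>x\<in>P. \<bar>apply_bcontfun g x - apply_bcontfun f x\<bar> < e) \<longrightarrow> c < G (a *\<^sub>R g + u))"
    using Pe(1,2) by (intro exI[of _ P] exI[of _ "e / (\<bar>a\<bar> + 1)"]) auto
qed

lemma pointwise_lsc_dist: "pointwise_lsc (\<lambda>f :: 'x::topological_space \<Rightarrow>\<^sub>C real. \<bar>f x - f y\<bar>)"
  unfolding pointwise_lsc_def
proof (intro allI impI)
  fix f :: "'x \<Rightarrow>\<^sub>C real" and c assume "c < \<bar>f x - f y\<bar>"
  then show "\<exists>P e. finite P \<and> 0 < e \<and> (\<forall>g. (\<forall>x\<in>P. \<bar>apply_bcontfun g x - apply_bcontfun f x\<bar> < e) \<longrightarrow> c < \<bar>apply_bcontfun g x - apply_bcontfun g y\<bar>)"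
  proof (intro exI[of _ "{x, y}"] exI[of _ "(\<bar>f x - f y\<bar> - c) / 2"] conjI allI impI)
    fix g assume "\<forall>z\<in>{x, y}. \<bar>apply_bcontfun g z - apply_bcontfun f z\<bar> < (\<bar>f x - f y\<bar> - c) / 2"
    then have "\<bar>apply_bcontfun g x - f x\<bar> < (\<bar>f x - f y\<bar> - c) / 2"
      "\<bar>apply_bcontfun g y - f y\<bar> < (\<bar>f x - f y\<bar> - c) / 2" by auto
    moreover have "\<bar>f x - f y\<bar> \<le> \<bar>apply_bcontfun g x - apply_bcontfun g y\<bar> +
        \<bar>apply_bcontfun g x - f x\<bar> + \<bar>apply_bcontfun g y - f y\<bar>" by simp
    ultimately show "c < \<bar>apply_bcontfun g x - apply_bcontfun g y\<bar>" by argo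
  qed auto
qed

text \<open>A supremum norm above \<open>c\<close> is witnessed by the value at one point, and
  closeness to \<open>f\<close> at that point keeps the norm above \<open>c\<close>.\<close>

lemma pointwise_lsc_norm: "pointwise_lsc norm"
  unfolding pointwise_lsc_def
proof (intro allI impI)
  fix f :: "'a \<Rightarrow>\<^sub>C real" and c assume c: "c < norm f"
  have "\<exists>x. c < \<bar>f x\<bar>"
  proof (rule ccontr)
    assume "\<nexists>x. c < \<bar>f x\<bar>"
    then have "norm f \<le> c" by (intro norm_bound) (auto simp: not_less)
    then show False using c by simp
  qed
  then obtain x where x: "c < \<bar>f x\<bar>" ..
  have "c < norm g" if "\<forall>y\<in>{x}. \<bar>apply_bcontfun g y - apply_bcontfun f y\<bar> < \<bar>f x\<bar> - c" for g :: "'a \<Rightarrow>\<^sub>C real"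
    using that norm_bounded[of g x] by simp
  then show "\<exists>P e. finite P \<and> 0 < e \<and> (\<forall>g. (\<forall>x\<in>P. \<bar>apply_bcontfun g x - apply_bcontfun f x\<bar> < e) \<longrightarrow> c < norm g)"
    using x by (intro exI[of _ "{x}"] exI[of _ "\<bar>f x\<bar> - c"]) auto
qed

subsection \<open>Convexity defects\<close>

text \<open>For convex \<open>G\<close> the defect is nonnegative. Its tending to 0 takes over the
  role of midpoint norms tending to 1 on a unit sphere; it makes sense without homogeneity and is
  additive in \<open>G\<close>.\<close>

definition convexity_defect :: "('e::real_vector \<Rightarrow> real) \<Rightarrow> 'e \<Rightarrow> 'e \<Rightarrow> real"
  where "convexity_defect G f g = (G f + G g) / 2 - G ((1/2) *\<^sub>R (f + g))"

lemma convexity_defect_nonneg: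
  assumes "convex_on UNIV G"
  shows "0 \<le> convexity_defect G f g"
  using convex_onD[OF assms, of "1/2" f g] by (simp add: convexity_defect_def scaleR_add_right)

lemma convexity_defect_add:
  "convexity_defect (\<lambda>f. F f + G f) f g = convexity_defect F f g + convexity_defect G f g"
  by (simp add: convexity_defect_def field_simps)

lemma convexity_defect_cmult:
  "convexity_defect (\<lambda>f. c * F f) f g = c * convexity_defect F f g"
  by (simp add: convexity_defect_def field_simps)

lemma convexity_defect_diff:
  "convexity_defect (\<lambda>f. F (f - u)) f g = convexity_defect F (f - u) (g - u)"
proof -
  have "(f - u) + (g - u) = (f + g) - (u + u)" by simp
  then have "(1/2) *\<^sub>R ((f - u) + (g - u)) = (1/2) *\<^sub>R (f + g) - u"
    by (simp only: scaleR_diff_right scaleR_half_double)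
  then show ?thesis by (simp only: convexity_defect_def)
qed

text \<open>
  A variant of Deville's master lemma. If one member of a family dominates the others at \<open>f\<close> by a margin, a small defect of the
  supremum at \<open>f\<close> and \<open>g\<close> forces the supremum at the midpoint to be taken by that member.
\<close>

lemma convexity_defect_SUP:
  assumes convex: "\<And>i. i \<in> I \<Longrightarrow> convex_on UNIV (\<Theta> i)"
    and bdd: "\<And>f. bdd_above ((\<lambda>i. \<Theta> i f) ` I)"
    and i0: "i0 \<in> I"
    and gap: "\<And>i. i \<in> I \<Longrightarrow> i \<noteq> i0 \<Longrightarrow> \<Theta> i f \<le> (SUP i\<in>I. \<Theta> i f) - \<delta>"
    and small: "convexity_defect (\<lambda>f. SUP i\<in>I. \<Theta> i f) f g < \<delta> / 2"
  shows "convexity_defect (\<Theta> i0) f g \<le> convexity_defect (\<lambda>f. SUP i\<in>I. \<Theta> i f) f g"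
proof -
  define S where "S = (\<lambda>f. SUP i\<in>I. \<Theta> i f)"
  let ?m = "(1/2) *\<^sub>R (f + g)"
  have ub: "\<Theta> i h \<le> S h" if "i \<in> I" for i h
    unfolding S_def using that bdd by (intro cSUP_upper)
  \<comment> \<open>A competitor is \<delta> behind at \<open>f\<close> but possibly not at
    \<open>g\<close>, so averaging leaves a deficit of \<open>\<delta> / 2\<close>.\<close>
  have "\<Theta> i ?m \<le> max (\<Theta> i0 ?m) ((S f + S g) / 2 - \<delta> / 2)" if "i \<in> I" for i
  proof (cases "i = i0")
    case False
    have "0 \<le> convexity_defect (\<Theta> i) f g"
      using convex[OF that] by (rule convexity_defect_nonneg)
    moreover have "\<Theta> i f \<le> S f - \<delta>" "\<Theta> i g \<le> S g"
      using gap[OF that False] ub[OF that] by (auto simp: S_def)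
    ultimately show ?thesis unfolding convexity_defect_def by argo
  qed simp
  then have "S ?m \<le> max (\<Theta> i0 ?m) ((S f + S g) / 2 - \<delta> / 2)"
    unfolding S_def using i0 by (intro cSUP_least) auto
  moreover have "(S f + S g) / 2 - \<delta> / 2 < S ?m"
    using small unfolding convexity_defect_def S_def[symmetric] by argo
  ultimately have "S ?m \<le> \<Theta> i0 ?m" by simp
  then have "convexity_defect (\<Theta> i0) f g \<le> convexity_defect S f g"
    using ub[OF i0, of f] ub[OF i0, of g] unfolding convexity_defect_def by argo
  then show ?thesis by (simp add: S_def)
qed

text \<open>Boundedness on balls serves twice: it lets a weighted sum of countably many such
  functions stay finite, and it lets a small multiple of one of them be dominated by a fixed
  gap.\<close>

definition admissible :: "(('x::topological_space \<Rightarrow>\<^sub>C real) \<Rightarrow> real) \<Rightarrow> bool"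
  where "admissible G \<longleftrightarrow> (\<forall>f. 0 \<le> G f) \<and> convex_on UNIV G \<and> pointwise_lsc G \<and>
    (\<forall>r. \<exists>B. \<forall>f. norm f \<le> r \<longrightarrow> G f \<le> B)"

lemma convex_on_SUP:
  fixes G :: "'i \<Rightarrow> 'e::real_vector \<Rightarrow> real"
  assumes "I \<noteq> {}" "\<And>i. i \<in> I \<Longrightarrow> convex_on UNIV (G i)" "\<And>f. bdd_above ((\<lambda>i. G i f) ` I)"
  shows "convex_on UNIV (\<lambda>f. SUP i\<in>I. G i f)"
proof (rule convex_onI)
  fix t :: real and x y :: 'e assume t: "0 < t" "t < 1"
  show "(SUP i\<in>I. G i ((1 - t) *\<^sub>R x + t *\<^sub>R y)) \<le> (1 - t) * (SUP i\<in>I. G i x) + t * (SUP i\<in>I. G i y)"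
  proof (rule cSUP_least[OF assms(1)])
    fix i assume i: "i \<in> I"
    have "G i ((1 - t) *\<^sub>R x + t *\<^sub>R y) \<le> (1 - t) * G i x + t * G i y"
      using t by (intro convex_onD[OF assms(2)[OF i]]) auto
    also have "\<dots> \<le> (1 - t) * (SUP i\<in>I. G i x) + t * (SUP i\<in>I. G i y)"
      using t i assms(3) by (intro add_mono mult_left_mono cSUP_upper) auto
    finally show "G i ((1 - t) *\<^sub>R x + t *\<^sub>R y) \<le> (1 - t) * (SUP i\<in>I. G i x) + t * (SUP i\<in>I. G i y)" .
  qed
qed simp

lemma admissible_SUP:
  assumes ne: "I \<noteq> {}" and adm: "\<And>i. i \<in> I \<Longrightarrow> admissible (G i)"
    and bound: "\<And>r. \<exists>B. \<forall>i\<in>I. \<forall>f. norm f \<le> r \<longrightarrow> G i f \<le> B"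
  shows "admissible (\<lambda>f. SUP i\<in>I. G i f)"
proof -
  have bdd: "bdd_above ((\<lambda>i. G i f) ` I)" for f
    using bound[of "norm f"] by (auto simp: bdd_above_def)
  have "0 \<le> (SUP i\<in>I. G i f)" for f
  proof -
    obtain i where i: "i \<in> I" using ne by auto
    then have "0 \<le> G i f" using adm by (auto simp: admissible_def)
    also have "\<dots> \<le> (SUP i\<in>I. G i f)" using i bdd by (intro cSUP_upper)
    finally show ?thesis .
  qed
  moreover have "\<exists>B. \<forall>f. norm f \<le> r \<longrightarrow> (SUP i\<in>I. G i f) \<le> B" for r
    using bound[of r] ne by (meson cSUP_least)
  moreover have "convex_on UNIV (\<lambda>f. SUP i\<in>I. G i f)"
    using ne adm bdd by (intro convex_on_SUP) (auto simp: admissible_def)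
  moreover have "pointwise_lsc (\<lambda>f. SUP i\<in>I. G i f)"
    using ne adm bdd by (intro pointwise_lsc_SUP) (auto simp: admissible_def)
  ultimately show ?thesis by (auto simp: admissible_def)
qed

lemma admissible_add:
  assumes "admissible F" "admissible G"
  shows "admissible (\<lambda>f. F f + G f)"
proof -
  have "\<exists>B. \<forall>f. norm f \<le> r \<longrightarrow> F f + G f \<le> B" for r
    using assms unfolding admissible_def by (meson add_mono)
  then show ?thesis
    using assms by (auto simp: admissible_def intro: convex_on_add pointwise_lsc_add)
qed

lemma admissible_0: "admissible (\<lambda>f. 0)"
  by (auto simp: admissible_def pointwise_lsc_const convex_on_const)

lemma admissible_sum:
  assumes "finite A" "\<And>t. t \<in> A \<Longrightarrow> admissible (G t)"
  shows "admissible (\<lambda>f. \<Sum>t\<in>A. G t f)"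
  using assms by (induction A rule: finite_induct) (auto simp: admissible_0 admissible_add)

lemma admissible_cmult:
  assumes "admissible G" "0 \<le> c"
  shows "admissible (\<lambda>f. c * G f)"
proof -
  have "\<exists>B. \<forall>f. norm f \<le> r \<longrightarrow> c * G f \<le> B" for r
    using assms unfolding admissible_def by (meson mult_left_mono)
  moreover have "pointwise_lsc (\<lambda>f. c * G f)"
    using assms by (intro pointwise_lsc_compose[of G "(*) c"])
      (auto simp: admissible_def mono_on_def intro: mult_left_mono continuous_intros)
  ultimately show ?thesis
    using assms by (auto simp: admissible_def intro: convex_on_cmul)
qed

lemma admissible_affine:
  assumes "admissible G"
  shows "admissible (\<lambda>f. G (a *\<^sub>R f + u))"
proof -
  have "\<exists>B. \<forall>f. norm f \<le> r \<longrightarrow> G (a *\<^sub>R f + u) \<le> B" for r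
  proof -
    obtain B where "\<And>f. norm f \<le> \<bar>a\<bar> * r + norm u \<Longrightarrow> G f \<le> B"
      using assms unfolding admissible_def by metis
    moreover have "norm (a *\<^sub>R f + u) \<le> \<bar>a\<bar> * r + norm u" if "norm f \<le> r" for f
      using that norm_triangle_ineq[of "a *\<^sub>R f" u] mult_left_mono[of "norm f" r "\<bar>a\<bar>"] by simp
    ultimately show ?thesis by blast
  qed
  moreover have "convex_on UNIV (\<lambda>f. G (a *\<^sub>R f + u))"
  proof (rule convex_onI)
    fix t :: real and x y :: "'a \<Rightarrow>\<^sub>C real" assume t: "0 < t" "t < 1"
    have "a *\<^sub>R ((1 - t) *\<^sub>R x + t *\<^sub>R y) + u = (1 - t) *\<^sub>R (a *\<^sub>R x + u) + t *\<^sub>R (a *\<^sub>R y + u)"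
      by (simp add: algebra_simps)
    then show "G (a *\<^sub>R ((1 - t) *\<^sub>R x + t *\<^sub>R y) + u)
        \<le> (1 - t) * G (a *\<^sub>R x + u) + t * G (a *\<^sub>R y + u)"
      using assms t by (auto simp: admissible_def intro!: convex_onD)
  qed simp
  ultimately show ?thesis
    using assms by (auto simp: admissible_def pointwise_lsc_affine)
qed

lemma admissible_diff: "admissible G \<Longrightarrow> admissible (\<lambda>f. G (f - u))"
  using admissible_affine[of G 1 "- u"] by simp

lemma admissible_uminus: "admissible G \<Longrightarrow> admissible (\<lambda>f. G (- f))"
  using admissible_affine[of G "- 1" 0] by simp

lemma admissible_norm: "admissible norm"
  by (use convex_on_dist[of UNIV "0 :: _ \<Rightarrow>\<^sub>C real"] in \<open>auto simp: admissible_def pointwise_lsc_norm\<close>)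

lemma admissible_norm_power2: "admissible (\<lambda>f. (norm f)\<^sup>2)"
proof -
  have "convex_on UNIV (\<lambda>f :: 'a \<Rightarrow>\<^sub>C real. (norm f)\<^sup>2)"
  proof (rule convex_onI)
    fix t :: real and x y :: "'a \<Rightarrow>\<^sub>C real" assume t: "0 < t" "t < 1"
    have "norm ((1 - t) *\<^sub>R x + t *\<^sub>R y) \<le> (1 - t) * norm x + t * norm y"
      using t norm_triangle_ineq[of "(1 - t) *\<^sub>R x" "t *\<^sub>R y"] by simp
    then have "(norm ((1 - t) *\<^sub>R x + t *\<^sub>R y))\<^sup>2 \<le> ((1 - t) * norm x + t * norm y)\<^sup>2"
      by (intro power_mono) auto
    also have "\<dots> \<le> (1 - t) * (norm x)\<^sup>2 + t * (norm y)\<^sup>2"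
      using t convex_onD[OF convex_power2, of t "norm x" "norm y"] by simp
    finally show "(norm ((1 - t) *\<^sub>R x + t *\<^sub>R y))\<^sup>2 \<le> (1 - t) * (norm x)\<^sup>2 + t * (norm y)\<^sup>2" .
  qed simp
  moreover have "pointwise_lsc (\<lambda>f :: 'a \<Rightarrow>\<^sub>C real. (norm f)\<^sup>2)"
    by (intro pointwise_lsc_compose[of norm "\<lambda>s. s\<^sup>2"])
      (auto simp: pointwise_lsc_norm mono_on_def intro: power_mono continuous_intros)
  moreover have "\<exists>B. \<forall>f :: 'a \<Rightarrow>\<^sub>C real. norm f \<le> r \<longrightarrow> (norm f)\<^sup>2 \<le> B" for r
    by (intro exI[of _ "r\<^sup>2"]) (auto intro: power_mono)
  ultimately show ?thesis by (auto simp: admissible_def)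
qed

subsection \<open>From convex functions to norms\<close>

lemma pos_cut_eqI:
  fixes a b :: real
  assumes "0 \<le> a" "0 \<le> b" "\<And>c. 0 < c \<Longrightarrow> a \<le> c \<longleftrightarrow> b \<le> c"
  shows "a = b"
proof (rule antisym)
  show "a \<le> b"
  proof (rule dense_ge)
    fix c assume "b < c"
    with assms(2) have "0 < c" by simp
    with assms(3)[of c] \<open>b < c\<close> show "a \<le> c" by simp
  qed
  show "b \<le> a"
  proof (rule dense_ge)
    fix c assume "a < c"
    with assms(1) have "0 < c" by simp
    with assms(3)[of c] \<open>a < c\<close> show "b \<le> c" by simp
  qed
qed

text \<open>The norm is the Minkowski gauge of the sublevel set at height \<open>F 0 + 1\<close>,
  which contains a ball around 0 and is bounded because \<open>F\<close> dominates the norm.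
  \<open>F\<close> equals the height on the whole gauge sphere, so for two points of the sphere the
  defect of \<open>F\<close> is the drop of \<open>F\<close> at their midpoint. When the gauge of
  the midpoint tends to 1 this drop tends to 0, and the hypothesis on \<open>F\<close>
  applies.\<close>

lemma ex_LUR_norm_if_convex:
  fixes F :: "('x::topological_space \<Rightarrow>\<^sub>C real) \<Rightarrow> real"
  assumes F: "admissible F" and even: "\<And>f. F (- f) = F f" and norm_le: "\<And>f. norm f \<le> F f"
    and LUR: "\<And>f fs. bounded (range fs) \<Longrightarrow> (\<lambda>n. convexity_defect F f (fs n)) \<longlonglongrightarrow> 0
      \<Longrightarrow> (\<lambda>n. norm (f - fs n)) \<longlonglongrightarrow> 0"
  shows "\<exists>N :: ('x \<Rightarrow>\<^sub>C real) \<Rightarrow> real. equivalent_norm N \<and> LUR_norm N \<and> lower_semicontinuous_map pointwise_topology N"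
proof -
  have cvx: "convex_on UNIV F" and lsc: "pointwise_lsc F"
    using F by (auto simp: admissible_def)
  have nonneg: "0 \<le> F f" for f
    using F by (simp add: admissible_def)
  have bounded: "\<exists>B. \<forall>f. norm f \<le> r \<longrightarrow> F f \<le> B" for r
    using F by (simp add: admissible_def)
  have conv: "F ((1 - t) *\<^sub>R f + t *\<^sub>R g) \<le> (1 - t) * F f + t * F g"
    if "0 \<le> t" "t \<le> 1" for t f g
    using convex_onD[OF cvx that] by simp
  define R where "R = F 0 + 1"
  have R: "0 < R" using nonneg[of 0] by (simp add: R_def)
  obtain M0 where M0: "\<And>f. norm f \<le> 1 \<Longrightarrow> F f \<le> M0" using bounded by metis
  \<comment> \<open>The maximum with \<open>R\<close> gives \<open>M - F 0 \<ge> 1\<close>, so that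
    \<delta> below is at most 1 and can be a convex coefficient. It solves
    \<open>(1 - \<delta>) * F 0 + \<delta> * M = R\<close>.\<close>
  define M where "M = max M0 R"
  have M: "F f \<le> M" if "norm f \<le> 1" for f using M0[OF that] by (simp add: M_def)
  define \<delta> where "\<delta> = 1 / (M - F 0)"
  have "M - F 0 \<ge> 1" by (simp add: M_def R_def)
  then have \<delta>: "0 < \<delta>" "\<delta> \<le> 1" "\<delta> * (M - F 0) = 1" by (auto simp: \<delta>_def)
  have small: "F f \<le> R" if "norm f \<le> \<delta>" for f
  proof -
    have "F f \<le> (1 - \<delta>) * F 0 + \<delta> * F ((1 / \<delta>) *\<^sub>R f)"
      using conv[of \<delta> 0 "(1 / \<delta>) *\<^sub>R f"] \<delta> by simp
    also have "F ((1 / \<delta>) *\<^sub>R f) \<le> M" using that \<delta> by (intro M) (simp add: field_simps)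
    then have "(1 - \<delta>) * F 0 + \<delta> * F ((1 / \<delta>) *\<^sub>R f) \<le> (1 - \<delta>) * F 0 + \<delta> * M"
      using \<delta> by (simp add: mult_left_mono)
    also have "\<dots> = R" using \<delta>(3) by (simp add: R_def algebra_simps)
    finally show ?thesis .
  qed
  have mono: "F ((1 / \<mu>) *\<^sub>R f) \<le> R" if "0 < \<kappa>" "\<kappa> \<le> \<mu>" "F ((1 / \<kappa>) *\<^sub>R f) \<le> R" for \<kappa> \<mu> f
  proof -
    have "F ((1 / \<mu>) *\<^sub>R f) \<le> (1 - \<kappa> / \<mu>) * F 0 + \<kappa> / \<mu> * F ((1 / \<kappa>) *\<^sub>R f)"
      using conv[of "\<kappa> / \<mu>" 0 "(1 / \<kappa>) *\<^sub>R f"] that by simp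
    also have "\<dots> \<le> (1 - \<kappa> / \<mu>) * R + \<kappa> / \<mu> * R"
      using that by (intro add_mono mult_left_mono) (auto simp: R_def)
    finally show ?thesis by (simp add: algebra_simps)
  qed
  define N where "N = (\<lambda>f. Inf {\<kappa>. 0 < \<kappa> \<and> F ((1 / \<kappa>) *\<^sub>R f) \<le> R})"
  have bdd: "bdd_below {\<kappa>. 0 < \<kappa> \<and> F ((1 / \<kappa>) *\<^sub>R f) \<le> R}" for f
    by (rule bdd_belowI[of _ 0]) auto
  have ne: "{\<kappa>. 0 < \<kappa> \<and> F ((1 / \<kappa>) *\<^sub>R f) \<le> R} \<noteq> {}" for f
  proof -
    have "norm ((1 / ((norm f + 1) / \<delta>)) *\<^sub>R f) \<le> \<delta>"
    proof -
      have "norm f / (norm f + 1) \<le> 1" by (simp add: add_nonneg_pos)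
      then have "\<delta> * (norm f / (norm f + 1)) \<le> \<delta> * 1" using \<delta>(1) by (intro mult_left_mono) auto
      then show ?thesis using \<delta>(1) by simp
    qed
    moreover have "0 < (norm f + 1) / \<delta>" using \<delta>(1) by (simp add: add_nonneg_pos)
    ultimately show ?thesis using small by blast
  qed
  have N_nonneg: "0 \<le> N f" for f
    unfolding N_def using ne by (intro cInf_greatest) auto
  \<comment> \<open>Lower semicontinuity closes the sublevel set along rays, so
    \<open>N f \<le> c\<close> is decided at the scale \<open>c\<close> itself and not only at
    larger scales.\<close>
  have N_le: "N f \<le> c \<longleftrightarrow> F ((1 / c) *\<^sub>R f) \<le> R" if c: "0 < c" for f c
  proof
    assume "F ((1 / c) *\<^sub>R f) \<le> R"
    then show "N f \<le> c" unfolding N_def using bdd c by (intro cInf_lower) auto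
  next
    assume Nf: "N f \<le> c"
    show "F ((1 / c) *\<^sub>R f) \<le> R"
    proof (rule ccontr)
      assume "\<not> F ((1 / c) *\<^sub>R f) \<le> R"
      then have "R < F ((1 / c) *\<^sub>R f)" by simp
      with lsc obtain P e where Pe: "finite P" "0 < e"
        "\<And>g. (\<And>x. x \<in> P \<Longrightarrow> \<bar>apply_bcontfun g x - apply_bcontfun ((1 / c) *\<^sub>R f) x\<bar> < e) \<Longrightarrow> R < F g"
        by (rule pointwise_lscD) blast
      \<comment> \<open>Rescaling by \<open>1 + s\<close> moves the values of
        \<open>(1 / c) *\<^sub>R f\<close> by at most \<open>norm f * (s / c)\<close>, which this
        choice keeps below \<open>e\<close>.\<close>
      define s where "s = e * c / (norm f + 1)"
      have nf: "0 < norm f + 1" by (simp add: add_nonneg_pos)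
      then have s: "0 < s" using Pe(2) c by (simp add: s_def)
      have "R < F ((1 / (c * (1 + s))) *\<^sub>R f)"
      proof (rule Pe(3))
        fix x
        have "\<bar>apply_bcontfun ((1 / (c * (1 + s))) *\<^sub>R f) x - apply_bcontfun ((1 / c) *\<^sub>R f) x\<bar>
            = \<bar>f x\<bar> * \<bar>1 / (c * (1 + s)) - 1 / c\<bar>"
          by (simp add: abs_mult[symmetric] algebra_simps)
        also have "1 / (c * (1 + s)) - 1 / c = (1 / (1 + s) - 1) / c"
          using c s by (simp add: diff_divide_distrib)
        also have "1 / (1 + s) - 1 = - (s / (1 + s))" using s by (simp add: field_simps)
        also have "\<bar>- (s / (1 + s)) / c\<bar> = s / (1 + s) / c" using c s by simp
        also have "\<bar>f x\<bar> * (s / (1 + s) / c) \<le> norm f * (s / c)"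
          using c s norm_bounded[of f x]
          by (intro mult_mono divide_right_mono) (auto simp: field_simps)
        also have "norm f * (s / c) = e * (norm f / (norm f + 1))"
          using c by (simp add: s_def)
        also have "\<dots> < e * 1" using nf Pe(2) by (intro mult_strict_left_mono) auto
        finally show "\<bar>apply_bcontfun ((1 / (c * (1 + s))) *\<^sub>R f) x
            - apply_bcontfun ((1 / c) *\<^sub>R f) x\<bar> < e" by simp
      qed
      moreover have "N f < c * (1 + s)" using Nf mult_pos_pos[OF c s] by (simp add: algebra_simps)
      then obtain \<kappa> where "0 < \<kappa>" "F ((1 / \<kappa>) *\<^sub>R f) \<le> R" "\<kappa> < c * (1 + s)"
        unfolding N_def using cInf_lessD[OF ne] by blast
      then have "F ((1 / (c * (1 + s))) *\<^sub>R f) \<le> R" using mono[of \<kappa> "c * (1 + s)" f] by simp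
      ultimately show False by simp
    qed
  qed
  have N_0: "N 0 = 0"
    using N_nonneg by (intro pos_cut_eqI) (auto simp: N_le R_def)
  have N_scale: "N (a *\<^sub>R f) = \<bar>a\<bar> * N f" for a f
  proof (cases "a = 0")
    case False
    show ?thesis
    proof (rule pos_cut_eqI)
      fix c :: real assume c: "0 < c"
      have "F ((1 / c) *\<^sub>R a *\<^sub>R f) = F ((1 / (c / \<bar>a\<bar>)) *\<^sub>R f)"
        using False even[of "(a / c) *\<^sub>R f"] by (cases "0 < a") auto
      then show "N (a *\<^sub>R f) \<le> c \<longleftrightarrow> \<bar>a\<bar> * N f \<le> c"
        using N_le[OF c, of "a *\<^sub>R f"] N_le[of "c / \<bar>a\<bar>" f] c False by (simp add: field_simps)
    qed (simp_all add: N_nonneg)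
  qed (simp add: N_0)
  have N_triangle: "N (f + g) \<le> N f + N g" for f g
  proof (rule field_le_epsilon)
    fix e :: real assume e: "0 < e"
    define c d where "c = N f + e / 2" and "d = N g + e / 2"
    have cd: "0 < c" "0 < d" using e N_nonneg by (auto simp: c_def d_def add_nonneg_pos)
    define t where "t = d / (c + d)"
    have t: "0 \<le> t" "t \<le> 1" "1 - t = c / (c + d)" using cd by (auto simp: t_def field_simps)
    have "(1 / (c + d)) *\<^sub>R (f + g) = (1 - t) *\<^sub>R ((1 / c) *\<^sub>R f) + t *\<^sub>R ((1 / d) *\<^sub>R g)"
      using cd unfolding t(3) by (simp add: t_def algebra_simps)
    moreover have "F ((1 / c) *\<^sub>R f) \<le> R" "F ((1 / d) *\<^sub>R g) \<le> R"
      using cd e by (auto simp: N_le[symmetric] c_def d_def)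
    then have "(1 - t) * F ((1 / c) *\<^sub>R f) + t * F ((1 / d) *\<^sub>R g) \<le> (1 - t) * R + t * R"
      using t by (intro add_mono mult_left_mono) auto
    ultimately have "F ((1 / (c + d)) *\<^sub>R (f + g)) \<le> R"
      using conv[OF t(1,2), of "(1 / c) *\<^sub>R f" "(1 / d) *\<^sub>R g"] by (simp add: algebra_simps)
    then have "N (f + g) \<le> c + d" using cd by (simp add: N_le)
    then show "N (f + g) \<le> N f + N g + e" by (simp add: c_def d_def)
  qed
  have N_upper: "N f \<le> (1 / \<delta>) * norm f" for f
  proof (cases "f = 0")
    case False
    then have "F ((1 / (1 / \<delta> * norm f)) *\<^sub>R f) \<le> R" using \<delta> by (intro small) simp
    then show ?thesis using False \<delta> by (subst N_le) auto
  qed (simp add: N_0)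
  have N_lower: "1 / R * norm f \<le> N f" for f
  proof (rule dense_ge)
    fix c assume "N f < c"
    then have c: "0 < c" "F ((1 / c) *\<^sub>R f) \<le> R"
      using N_nonneg[of f] N_le[of c f] by auto
    then have "norm ((1 / c) *\<^sub>R f) \<le> R" using norm_le order_trans by blast
    then show "1 / R * norm f \<le> c" using c R by (simp add: field_simps)
  qed
  have N_eq_0: "N f = 0 \<longleftrightarrow> f = 0" for f
  proof
    assume "N f = 0"
    then have "1 / R * norm f \<le> 0" using N_lower[of f] by simp
    then show "f = 0" using R by (simp add: field_simps)
  qed (simp add: N_0)
  have equiv: "equivalent_norm N"
    unfolding equivalent_norm_def
  proof (intro conjI allI)
    show "\<exists>c>0. \<exists>C>0. \<forall>x. c * norm x \<le> N x \<and> N x \<le> C * norm x"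
    proof (rule exI[of _ "1 / R"], intro conjI, use R in simp, rule exI[of _ "1 / \<delta>"], intro conjI allI)
      show "0 < 1 / \<delta>" using \<delta>(1) by simp
    qed (rule N_lower N_upper)+
  qed (use N_eq_0 N_scale N_triangle in auto)
  \<comment> \<open>Going outward along a ray is a convex combination with
    \<open>2 *\<^sub>R f\<close>, so convexity bounds \<open>F\<close> outside the sphere from
    above.\<close>
  have double: "(1 + s) *\<^sub>R f = (1 - s) *\<^sub>R f + s *\<^sub>R (2 *\<^sub>R f)" for s and f :: "'x \<Rightarrow>\<^sub>C real"
  proof -
    have "1 + s = (1 - s) + s * 2" by simp
    then show ?thesis by (metis scaleR_add_left scaleR_scaleR)
  qed
  have F_eq: "F f = R" if Nf: "N f = 1" for f
  proof (rule ccontr)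
    assume "F f \<noteq> R"
    moreover have "F f \<le> R" using N_le[of 1 f] Nf by simp
    ultimately have less: "F f < R" by simp
    define B where "B = F (2 *\<^sub>R f)"
    have B: "0 \<le> B" using nonneg by (simp add: B_def)
    \<comment> \<open>The growth of \<open>F\<close> from \<open>f\<close> to
      \<open>(1 + s) *\<^sub>R f\<close> is at most \<open>s * B\<close>, which must fit into the
      slack \<open>R - F f\<close>.\<close>
    define s where "s = min 1 ((R - F f) / (B + 1))"
    have "s \<le> (R - F f) / (B + 1)" by (simp add: s_def)
    then have "s * (B + 1) \<le> R - F f"
      using B by (simp only: pos_le_divide_eq[of "B + 1"])
    moreover have "0 < s" "s \<le> 1" using less B by (auto simp: s_def)
    ultimately have s: "0 < s" "s \<le> 1" "s * (B + 1) \<le> R - F f" by auto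
    have "F ((1 + s) *\<^sub>R f) = F ((1 - s) *\<^sub>R f + s *\<^sub>R (2 *\<^sub>R f))"
      by (simp only: double)
    also have "\<dots> \<le> (1 - s) * F f + s * B"
      unfolding B_def using s by (intro conv) auto
    also have "\<dots> \<le> R"
      using s mult_nonneg_nonneg[OF less_imp_le[OF s(1)] nonneg[of f]] by (simp add: algebra_simps)
    finally have "N f \<le> 1 / (1 + s)" using s by (subst N_le) auto
    also have "\<dots> < 1" using s by simp
    finally show False using Nf by simp
  qed
  have "LUR_norm N"
    unfolding LUR_norm_def
  proof (intro allI impI, elim conjE)
    fix x xs
    assume x: "N x = 1" and xs: "\<forall>n. N (xs n) = 1"
      and lim: "(\<lambda>n. N ((1/2) *\<^sub>R (x + xs n))) \<longlonglongrightarrow> 1"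
    define mid where "mid = (\<lambda>n. (1/2) *\<^sub>R (x + xs n))"
    have norm_R: "norm f \<le> R" if "N f \<le> 1" for f
    proof -
      have "norm f \<le> R * N f" using N_lower[of f] R by (simp add: field_simps)
      also have "\<dots> \<le> R * 1" using that R by (intro mult_left_mono) auto
      finally show ?thesis by simp
    qed
    have mid_1: "N (mid n) \<le> 1" for n
      using N_triangle[of x "xs n"] x xs N_scale[of "1/2" "x + xs n"] by (simp add: mid_def)
    obtain B where B: "\<And>f. norm f \<le> 2 * R \<Longrightarrow> F f \<le> B" using bounded by metis
    have defect: "convexity_defect F x (xs n) = R - F (mid n)" for n
      using x xs by (simp add: convexity_defect_def F_eq mid_def)
    \<comment> \<open>The midpoint is pushed back to the sphere by the factor
      \<open>1 / N (mid n)\<close>, where \<open>F\<close> is \<open>R\<close> again. The bound 1/2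
      keeps the excess \<open>s\<close> of this factor over 1 at most 1, as convexity
      requires.\<close>
    have upper: "R - F (mid n) \<le> (1 / N (mid n) - 1) * B" if n: "1/2 < N (mid n)" for n
    proof -
      define s where "s = 1 / N (mid n) - 1"
      have s: "0 \<le> s" "s \<le> 1" using n mid_1[of n] by (auto simp: s_def field_simps)
      have "N ((1 + s) *\<^sub>R mid n) = 1" using n by (simp add: N_scale s_def)
      then have "R = F ((1 + s) *\<^sub>R mid n)" by (simp add: F_eq)
      also have "(1 + s) *\<^sub>R mid n = (1 - s) *\<^sub>R mid n + s *\<^sub>R (2 *\<^sub>R mid n)"
        by (simp only: double)
      also have "F \<dots> \<le> (1 - s) * F (mid n) + s * F (2 *\<^sub>R mid n)"
        using s by (rule conv)
      also have "F (2 *\<^sub>R mid n) \<le> B"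
        using norm_R[OF mid_1[of n]] by (intro B) simp
      then have "(1 - s) * F (mid n) + s * F (2 *\<^sub>R mid n) \<le> (1 - s) * F (mid n) + s * B"
        using s by (simp add: mult_left_mono)
      also have "\<dots> \<le> F (mid n) + s * B"
        using s nonneg[of "mid n"] by (simp add: algebra_simps)
      finally show ?thesis by (simp add: s_def)
    qed
    have lim': "(\<lambda>n. N (mid n)) \<longlonglongrightarrow> 1" using lim by (simp add: mid_def)
    then have ev: "\<forall>\<^sub>F n in sequentially. 1/2 < N (mid n)"
      by (rule order_tendstoD) simp
    have "(\<lambda>n. (1 / N (mid n) - 1) * B) \<longlonglongrightarrow> (1 / 1 - 1) * B"
      by (intro tendsto_intros lim') simp
    then have "(\<lambda>n. (1 / N (mid n) - 1) * B) \<longlonglongrightarrow> 0" by simp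
    then have "(\<lambda>n. convexity_defect F x (xs n)) \<longlonglongrightarrow> 0"
    proof (rule tendsto_sandwich[OF _ _ tendsto_const, rotated 2])
      show "\<forall>\<^sub>F n in sequentially. convexity_defect F x (xs n) \<le> (1 / N (mid n) - 1) * B"
        using ev by eventually_elim (simp add: defect upper)
    qed (simp add: convexity_defect_nonneg[OF cvx])
    moreover have "bounded (range xs)"
      using norm_R xs by (intro boundedI[of _ R]) auto
    ultimately have "(\<lambda>n. norm (x - xs n)) \<longlonglongrightarrow> 0" by (intro LUR)
    then have "(\<lambda>n. (1 / \<delta>) * norm (x - xs n)) \<longlonglongrightarrow> (1 / \<delta>) * 0"
      by (intro tendsto_mult tendsto_const)
    then have "(\<lambda>n. (1 / \<delta>) * norm (x - xs n)) \<longlonglongrightarrow> 0" by simp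
    then show "(\<lambda>n. N (x - xs n)) \<longlonglongrightarrow> 0"
    proof (rule tendsto_sandwich[OF _ _ tendsto_const, rotated 2])
      show "\<forall>\<^sub>F n in sequentially. N (x - xs n) \<le> (1 / \<delta>) * norm (x - xs n)"
        using N_upper by (rule always_eventually[OF allI])
    qed (simp add: N_nonneg)
  qed
  moreover have "pointwise_lsc N"
    unfolding pointwise_lsc_def
  proof (intro allI impI)
    fix f c assume c: "c < N f"
    show "\<exists>P e. finite P \<and> 0 < e \<and> (\<forall>g. (\<forall>x\<in>P. \<bar>apply_bcontfun g x - apply_bcontfun f x\<bar> < e) \<longrightarrow> c < N g)"
    proof (cases "c < 0")
      case True
      then have "c < N g" for g using N_nonneg[of g] by simp
      then show ?thesis by (intro exI[of _ "{}"] exI[of _ 1]) auto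
    next
      case False
      define d where "d = (c + N f) / 2"
      have d: "0 < d" "c < d" "d < N f" using c False by (auto simp: d_def)
      then have "R < F ((1 / d) *\<^sub>R f + 0)" using N_le[of d f] by simp
      with pointwise_lsc_affine[OF lsc, of "1 / d" 0]
      obtain P e where Pe: "finite P" "0 < e"
        "\<And>g. (\<And>x. x \<in> P \<Longrightarrow> \<bar>apply_bcontfun g x - apply_bcontfun f x\<bar> < e) \<Longrightarrow> R < F ((1 / d) *\<^sub>R g + 0)"
        by (rule pointwise_lscD) blast
      have "c < N g" if "R < F ((1 / d) *\<^sub>R g + 0)" for g
        using that N_le[of d g] d by simp
      then show ?thesis using Pe by (intro exI[of _ P] exI[of _ e]) simp
    qed
  qed
  ultimately show ?thesis using equiv lower_semicontinuous_map_pointwise[of N] by blast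
qed

text \<open>
  \<open>LUR_within K S\<close> is the local uniform rotundity condition at the points of \<open>S\<close> up to an error \<open>K\<close>,
  with convexity tested by countably many convex functions instead of a single norm.
\<close>

definition LUR_within :: "real \<Rightarrow> ('x::topological_space \<Rightarrow>\<^sub>C real) set \<Rightarrow> bool"
  where "LUR_within K S \<longleftrightarrow>
    (\<exists>\<G>. countable \<G> \<and> (\<forall>G\<in>\<G>. admissible G) \<and>
      (\<forall>f\<in>S. \<forall>fs. bounded (range fs) \<and> (\<forall>G\<in>\<G>. (\<lambda>n. convexity_defect G f (fs n)) \<longlonglongrightarrow> 0) \<longrightarrow>
        (\<forall>\<eta>>K. \<forall>\<^sub>F n in sequentially. norm (f - fs n) < \<eta>)))"

lemma LUR_withinI:
  assumes "countable \<G>" "\<And>G. G \<in> \<G> \<Longrightarrow> admissible G"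
    and "\<And>f fs \<eta>. \<lbrakk>f \<in> S; bounded (range fs); \<And>G. G \<in> \<G> \<Longrightarrow> (\<lambda>n. convexity_defect G f (fs n)) \<longlonglongrightarrow> 0; K < \<eta>\<rbrakk>
      \<Longrightarrow> \<forall>\<^sub>F n in sequentially. norm (f - fs n) < \<eta>"
  shows "LUR_within K S"
  unfolding LUR_within_def using assms by (intro exI[of _ \<G>]) blast

lemma LUR_withinE:
  assumes "LUR_within K S"
  obtains \<G> where "countable \<G>" "\<And>G. G \<in> \<G> \<Longrightarrow> admissible G"
    and "\<And>f fs \<eta>. \<lbrakk>f \<in> S; bounded (range fs); \<And>G. G \<in> \<G> \<Longrightarrow> (\<lambda>n. convexity_defect G f (fs n)) \<longlonglongrightarrow> 0; K < \<eta>\<rbrakk>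
      \<Longrightarrow> \<forall>\<^sub>F n in sequentially. norm (f - fs n) < \<eta>"
proof -
  from assms obtain \<G> where \<G>: "countable \<G>" "\<forall>G\<in>\<G>. admissible G"
    "\<forall>f\<in>S. \<forall>fs. bounded (range fs) \<and> (\<forall>G\<in>\<G>. (\<lambda>n. convexity_defect G f (fs n)) \<longlonglongrightarrow> 0) \<longrightarrow>
        (\<forall>\<eta>>K. \<forall>\<^sub>F n in sequentially. norm (f - fs n) < \<eta>)"
    unfolding LUR_within_def by (elim exE conjE)
  show thesis by (rule that[of \<G>]) (use \<G> in auto)
qed

lemma LUR_within_subset: "LUR_within K S \<Longrightarrow> T \<subseteq> S \<Longrightarrow> LUR_within K T"
  by (elim LUR_withinE, rule LUR_withinI) auto

lemma LUR_within_UN: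
  assumes "countable I" "\<And>i. i \<in> I \<Longrightarrow> LUR_within K (S i)"
  shows "LUR_within K (\<Union>i\<in>I. S i)"
proof -
  have "\<forall>i\<in>I. \<exists>\<G>. countable \<G> \<and> (\<forall>G\<in>\<G>. admissible G) \<and>
      (\<forall>f\<in>S i. \<forall>fs. bounded (range fs) \<and> (\<forall>G\<in>\<G>. (\<lambda>n. convexity_defect G f (fs n)) \<longlonglongrightarrow> 0) \<longrightarrow>
        (\<forall>\<eta>>K. \<forall>\<^sub>F n in sequentially. norm (f - fs n) < \<eta>))"
    using assms(2) by (simp add: LUR_within_def)
  from bchoice[OF this] obtain \<G> where \<G>: "\<And>i. i \<in> I \<Longrightarrow> countable (\<G> i)"
    "\<And>i G. i \<in> I \<Longrightarrow> G \<in> \<G> i \<Longrightarrow> admissible G"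
    "\<And>i f fs \<eta>. \<lbrakk>i \<in> I; f \<in> S i; bounded (range fs);
      \<And>G. G \<in> \<G> i \<Longrightarrow> (\<lambda>n. convexity_defect G f (fs n)) \<longlonglongrightarrow> 0; K < \<eta>\<rbrakk>
      \<Longrightarrow> \<forall>\<^sub>F n in sequentially. norm (f - fs n) < \<eta>"
    by metis
  show ?thesis
  proof (rule LUR_withinI)
    show "countable (\<Union>i\<in>I. \<G> i)" using assms(1) \<G>(1) by blast
    show "admissible G" if "G \<in> (\<Union>i\<in>I. \<G> i)" for G using that \<G>(2) by blast
    fix f fs \<eta>
    assume "f \<in> (\<Union>i\<in>I. S i)" "bounded (range fs)" "K < \<eta>"
      "\<And>G. G \<in> (\<Union>i\<in>I. \<G> i) \<Longrightarrow> (\<lambda>n. convexity_defect G f (fs n)) \<longlonglongrightarrow> 0"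
    then show "\<forall>\<^sub>F n in sequentially. norm (f - fs n) < \<eta>"
      using \<G>(3)[of _ f fs \<eta>] by blast
  qed
qed

text \<open>Families for the errors \<open>1 / (k + 1)\<close> are merged into one weighted sum. The
  summand \<open>norm\<close> makes it dominate the norm, and adding the value at \<open>- f\<close>
  makes it even. The sum is taken as a supremum of partial sums, so that admissibility is
  inherited.\<close>

lemma ex_LUR_norm_if_LUR_within:
  assumes "\<And>\<epsilon>. 0 < \<epsilon> \<Longrightarrow> LUR_within \<epsilon> (UNIV :: ('x::topological_space \<Rightarrow>\<^sub>C real) set)"
  shows "\<exists>N :: ('x \<Rightarrow>\<^sub>C real) \<Rightarrow> real.
    equivalent_norm N \<and> LUR_norm N \<and> lower_semicontinuous_map pointwise_topology N"
proof -
  have "\<forall>k::nat. \<exists>\<G>. countable \<G> \<and> (\<forall>G\<in>\<G>. admissible G) \<and>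
      (\<forall>f::'x \<Rightarrow>\<^sub>C real. \<forall>fs. bounded (range fs) \<and> (\<forall>G\<in>\<G>. (\<lambda>n. convexity_defect G f (fs n)) \<longlonglongrightarrow> 0) \<longrightarrow>
        (\<forall>\<eta>>1 / (real k + 1). \<forall>\<^sub>F n in sequentially. norm (f - fs n) < \<eta>))"
    using assms[of "1 / (real k + 1)" for k] by (simp add: LUR_within_def)
  from choice[OF this] obtain \<H> where \<H>: "\<And>k::nat. countable (\<H> k)"
    "\<And>k (G :: ('x \<Rightarrow>\<^sub>C real) \<Rightarrow> real). G \<in> \<H> k \<Longrightarrow> admissible G"
    "\<And>k (f :: 'x \<Rightarrow>\<^sub>C real) fs \<eta>. \<lbrakk>bounded (range fs);
      \<And>G. G \<in> \<H> k \<Longrightarrow> (\<lambda>n. convexity_defect G f (fs n)) \<longlonglongrightarrow> 0; 1 / (real k + 1) < \<eta>\<rbrakk>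
      \<Longrightarrow> \<forall>\<^sub>F n in sequentially. norm (f - fs n) < \<eta>"
    by metis
  \<comment> \<open>The zero function keeps the family nonempty, so that it is the range of a
    sequence.\<close>
  define \<G> where "\<G> = insert (\<lambda>_. 0) (\<Union>k. \<H> k)"
  define G where "G = from_nat_into \<G>"
  have "countable \<G>" "\<G> \<noteq> {}" using \<H>(1) by (auto simp: \<G>_def)
  then have range_G: "range G = \<G>" by (simp add: G_def range_from_nat_into)
  then have adm: "admissible (G m)" for m
  proof -
    have "G m \<in> \<G>" using range_G by blast
    then show ?thesis using \<H>(2) admissible_0 by (auto simp: \<G>_def)
  qed
  have nonneg: "0 \<le> G m f" for m f using adm by (simp add: admissible_def)
  \<comment> \<open>The radius grows with \<open>m\<close>, so a fixed ball is covered by the bounds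
    of all but finitely many terms.\<close>
  have "\<forall>m. \<exists>B. \<forall>f. norm f \<le> real m + 1 \<longrightarrow> G m f \<le> B"
    using adm by (auto simp: admissible_def)
  then obtain B where B: "\<And>m f. norm f \<le> real m + 1 \<Longrightarrow> G m f \<le> B m" by metis
  have B_nonneg: "0 \<le> B m" for m using B[of 0 m] nonneg[of m 0] by simp
  define w where "w = (\<lambda>m. (1/2) ^ m / (1 + B m))"
  have w: "0 < w m" for m using B_nonneg[of m] by (simp add: w_def add_pos_nonneg)
  define T where "T = (\<lambda>m f. w m * (G m f + G m (- f)))"
  have T_adm: "admissible (T m)" for m
    unfolding T_def using adm w[of m]
    by (intro admissible_cmult admissible_add admissible_uminus) (auto intro: less_imp_le)
  have T_nonneg: "0 \<le> T m f" for m f using T_adm by (simp add: admissible_def)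
  define P where "P = (\<lambda>n f. norm f + (\<Sum>m<n. T m f))"
  have P_adm: "admissible (P n)" for n
    unfolding P_def using T_adm by (intro admissible_add admissible_norm admissible_sum) auto
  have P_bound: "\<exists>C. \<forall>n f. norm f \<le> r \<longrightarrow> P n f \<le> C" for r
  proof -
    have "\<forall>m. \<exists>C. \<forall>f. norm f \<le> r \<longrightarrow> T m f \<le> C"
      using T_adm by (auto simp: admissible_def)
    then obtain C where C: "\<And>m f. norm f \<le> r \<Longrightarrow> T m f \<le> C m" by metis
    \<comment> \<open>The finitely many terms whose radius is still below \<open>r\<close> get some
      bound on the ball. For the others the weight leaves a geometric term; the factor 2 accounts
      for \<open>f\<close> and \<open>- f\<close>.\<close>
    define t where "t = (\<lambda>m. if real m + 1 < r then \<bar>C m\<bar> else 2 * (1/2) ^ m)"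
    have t_nonneg: "0 \<le> t m" for m by (simp add: t_def)
    have T_le: "T m f \<le> t m" if f: "norm f \<le> r" for m f
    proof (cases "real m + 1 < r")
      case True
      then show ?thesis using C[OF f, of m] by (simp add: t_def)
    next
      case False
      then have "G m f + G m (- f) \<le> B m + B m" using f by (intro add_mono B) auto
      also have "\<dots> \<le> 2 * (1 + B m)" by simp
      finally have "T m f \<le> w m * (2 * (1 + B m))"
        unfolding T_def using w[of m] by (intro mult_left_mono) auto
      also have "\<dots> = 2 * (1/2) ^ m"
      proof -
        have "1 + B m \<noteq> 0" using B_nonneg[of m] by linarith
        then have "w m * (1 + B m) = (1/2) ^ m" by (simp add: w_def)
        then show ?thesis by (simp only: mult.left_commute[of "w m"])
      qed
      finally show ?thesis using False by (simp add: t_def)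
    qed
    have "summable t"
    proof (rule summable_comparison_test_ev)
      have "\<forall>\<^sub>F m in sequentially. r \<le> real m"
        by (rule eventually_at_top_linorderI[of "nat \<lceil>r\<rceil>"]) linarith
      then show "\<forall>\<^sub>F m in sequentially. norm (t m) \<le> 2 * (1/2) ^ m"
        by eventually_elim (simp add: t_def)
      show "summable (\<lambda>m. 2 * (1/2 :: real) ^ m)"
        by (intro summable_mult summable_geometric) simp
    qed
    then have "(\<Sum>m<n. T m f) \<le> suminf t" if "norm f \<le> r" for n f
      using sum_le_suminf[of t "{..<n}"] t_nonneg sum_mono[of "{..<n}" "\<lambda>m. T m f" t] T_le[OF that]
      by fastforce
    then have "P n f \<le> r + suminf t" if "norm f \<le> r" for n f
      using that by (simp add: P_def add_mono)
    then show ?thesis by blast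
  qed
  define F where "F = (\<lambda>f. SUP n. P n f)"
  have F_adm: "admissible F"
    unfolding F_def using P_adm P_bound by (intro admissible_SUP) auto
  have P_lim: "(\<lambda>n. P n f) \<longlonglongrightarrow> F f" for f
    unfolding F_def
  proof (rule LIMSEQ_incseq_SUP)
    show "bdd_above (range (\<lambda>n. P n f))"
      using P_bound[of "norm f"] by (auto simp: bdd_above_def)
    show "incseq (\<lambda>n. P n f)"
      using T_nonneg by (intro incseq_SucI) (simp add: P_def)
  qed
  show ?thesis
  proof (rule ex_LUR_norm_if_convex[OF F_adm])
    show "F (- f) = F f" for f
      by (simp add: F_def P_def T_def add.commute)
    show "norm f \<le> F f" for f
      by (rule LIMSEQ_le_const[OF P_lim]) (auto simp: P_def T_nonneg sum_nonneg)
    fix f fs assume bnd: "bounded (range fs)"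
      and lim: "(\<lambda>n. convexity_defect F f (fs n)) \<longlonglongrightarrow> 0"
    \<comment> \<open>All summands have nonnegative defect, so the defect of the sum dominates that
      of each term.\<close>
    have defect_le: "w m * convexity_defect (G m) f g \<le> convexity_defect F f g" for m g
    proof (rule LIMSEQ_le_const)
      show "(\<lambda>n. convexity_defect (P n) f g) \<longlonglongrightarrow> convexity_defect F f g"
        unfolding convexity_defect_def by (intro tendsto_intros P_lim) simp
      have "w m * convexity_defect (G m) f g \<le> convexity_defect (P n) f g" if n: "n \<ge> Suc m" for n
      proof -
        have dT: "0 \<le> convexity_defect (T k) f g" for k
          using T_adm by (intro convexity_defect_nonneg) (simp add: admissible_def)
        have dP: "convexity_defect (P n) f g
            = convexity_defect norm f g + (\<Sum>k<n. convexity_defect (T k) f g)"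
          unfolding P_def convexity_defect_add
          by (simp add: convexity_defect_def sum.distrib sum_subtractf sum_divide_distrib[symmetric])
        have "0 \<le> convexity_defect (\<lambda>f. G m (- f)) f g"
          using admissible_uminus[OF adm[of m]]
          by (intro convexity_defect_nonneg) (simp add: admissible_def)
        then have "w m * convexity_defect (G m) f g \<le> convexity_defect (T m) f g"
          using w[of m] unfolding T_def convexity_defect_cmult convexity_defect_add
          by (intro mult_left_mono) auto
        also have "\<dots> \<le> (\<Sum>k<n. convexity_defect (T k) f g)"
          using n dT by (intro member_le_sum) auto
        also have "\<dots> \<le> convexity_defect (P n) f g"
          using convexity_defect_nonneg[of norm f g] admissible_norm[where 'a='x]
          by (simp add: dP admissible_def)
        finally show ?thesis .
      qed
      then show "\<exists>n0. \<forall>n\<ge>n0. w m * convexity_defect (G m) f g \<le> convexity_defect (P n) f g" by blast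
    qed
    have G_lim: "(\<lambda>n. convexity_defect (G m) f (fs n)) \<longlonglongrightarrow> 0" for m
    proof (rule tendsto_sandwich[OF _ _ tendsto_const])
      have "(\<lambda>n. convexity_defect F f (fs n) / w m) \<longlonglongrightarrow> 0 / w m"
        using lim w[of m] by (intro tendsto_divide tendsto_const) auto
      then show "(\<lambda>n. convexity_defect F f (fs n) / w m) \<longlonglongrightarrow> 0" by simp
      show "\<forall>\<^sub>F n in sequentially. convexity_defect (G m) f (fs n) \<le> convexity_defect F f (fs n) / w m"
        using defect_le w by (simp add: field_simps)
      show "\<forall>\<^sub>F n in sequentially. 0 \<le> convexity_defect (G m) f (fs n)"
        using adm by (simp add: admissible_def convexity_defect_nonneg)
    qed
    show "(\<lambda>n. norm (f - fs n)) \<longlonglongrightarrow> 0"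
    proof (rule LIMSEQ_I)
      fix r :: real assume "0 < r"
      then obtain k where k: "1 / (real k + 1) < r"
        using reals_Archimedean[of r] by (auto simp: inverse_eq_divide add.commute)
      have "(\<lambda>n. convexity_defect H f (fs n)) \<longlonglongrightarrow> 0" if "H \<in> \<H> k" for H
      proof -
        have "H \<in> range G" using that unfolding range_G \<G>_def by blast
        then show ?thesis using G_lim by blast
      qed
      then have "\<forall>\<^sub>F n in sequentially. norm (f - fs n) < r"
        using \<H>(3)[OF bnd _ k] by blast
      then show "\<exists>no. \<forall>n\<ge>no. norm (norm (f - fs n) - 0) < r"
        by (simp add: eventually_sequentially)
    qed
  qed
qed

subsection \<open>Oscillation\<close>

definition osc :: "'x set \<Rightarrow> ('x::topological_space \<Rightarrow>\<^sub>C real) \<Rightarrow> real"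
  where "osc D f = (SUP z\<in>D \<times> D. \<bar>f (fst z) - f (snd z)\<bar>)"

lemma abs_diff_le_norm:
  fixes f :: "'x::topological_space \<Rightarrow>\<^sub>C real"
  shows "\<bar>apply_bcontfun f x - apply_bcontfun f y\<bar> \<le> 2 * norm f"
  using norm_bounded[of f x] norm_bounded[of f y] by (simp add: abs_le_iff)

lemma bdd_above_osc:
  fixes f :: "'x::topological_space \<Rightarrow>\<^sub>C real"
  shows "bdd_above ((\<lambda>z. \<bar>apply_bcontfun f (fst z) - apply_bcontfun f (snd z)\<bar>) ` S)"
  using abs_diff_le_norm[of f] by (auto simp: bdd_above_def)

lemma abs_diff_le_osc: "x \<in> D \<Longrightarrow> y \<in> D \<Longrightarrow> \<bar>apply_bcontfun f x - apply_bcontfun f y\<bar> \<le> osc D f"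
  unfolding osc_def using cSUP_upper[OF _ bdd_above_osc, of "(x, y)" "D \<times> D" f] by simp

lemma osc_le:
  assumes "D \<noteq> {}" "\<And>x y. x \<in> D \<Longrightarrow> y \<in> D \<Longrightarrow> \<bar>apply_bcontfun f x - apply_bcontfun f y\<bar> \<le> c"
  shows "osc D f \<le> c"
  unfolding osc_def using assms by (intro cSUP_least) auto

text \<open>Each difference \<open>\<bar>f x - f y\<bar>\<close> is a seminorm that depends on two
  values only and is at most \<open>2 * norm f\<close>; the supremum inherits all of this.\<close>

lemma admissible_osc:
  fixes D :: "'x::topological_space set"
  assumes "D \<noteq> {}"
  shows "admissible (osc D)"
  unfolding osc_def
proof (rule admissible_SUP)
  show "\<exists>B. \<forall>z\<in>D \<times> D. \<forall>f :: 'x \<Rightarrow>\<^sub>C real. norm f \<le> r \<longrightarrow> \<bar>apply_bcontfun f (fst z) - apply_bcontfun f (snd z)\<bar> \<le> B" for r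
  proof (intro exI[of _ "2 * r"] ballI allI impI)
    fix z and f :: "'x \<Rightarrow>\<^sub>C real" assume "norm f \<le> r"
    then show "\<bar>apply_bcontfun f (fst z) - apply_bcontfun f (snd z)\<bar> \<le> 2 * r"
      using abs_diff_le_norm[of f "fst z" "snd z"] by linarith
  qed
  fix z assume "z \<in> D \<times> D"
  show "admissible (\<lambda>f :: 'x \<Rightarrow>\<^sub>C real. \<bar>apply_bcontfun f (fst z) - apply_bcontfun f (snd z)\<bar>)"
    unfolding admissible_def
  proof (intro conjI allI)
    show "\<exists>B. \<forall>f :: 'x \<Rightarrow>\<^sub>C real. norm f \<le> r \<longrightarrow> \<bar>apply_bcontfun f (fst z) - apply_bcontfun f (snd z)\<bar> \<le> B" for r
    proof (intro exI[of _ "2 * r"] allI impI)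
      fix f :: "'x \<Rightarrow>\<^sub>C real" assume "norm f \<le> r"
      then show "\<bar>apply_bcontfun f (fst z) - apply_bcontfun f (snd z)\<bar> \<le> 2 * r"
        using abs_diff_le_norm[of f "fst z" "snd z"] by linarith
    qed
    show "convex_on UNIV (\<lambda>f :: 'x \<Rightarrow>\<^sub>C real. \<bar>apply_bcontfun f (fst z) - apply_bcontfun f (snd z)\<bar>)"
    proof (rule convex_onI)
      fix t :: real and f g :: "'x \<Rightarrow>\<^sub>C real" assume t: "0 < t" "t < 1"
      have "\<bar>((1 - t) *\<^sub>R f + t *\<^sub>R g) (fst z) - ((1 - t) *\<^sub>R f + t *\<^sub>R g) (snd z)\<bar>
          = \<bar>(1 - t) * (f (fst z) - f (snd z)) + t * (g (fst z) - g (snd z))\<bar>"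
        by (simp add: algebra_simps)
      also have "\<dots> \<le> \<bar>(1 - t) * (f (fst z) - f (snd z))\<bar> + \<bar>t * (g (fst z) - g (snd z))\<bar>"
        by (rule abs_triangle_ineq)
      also have "\<dots> = (1 - t) * \<bar>f (fst z) - f (snd z)\<bar> + t * \<bar>g (fst z) - g (snd z)\<bar>"
        using t by (simp add: abs_mult)
      finally show "\<bar>((1 - t) *\<^sub>R f + t *\<^sub>R g) (fst z) - ((1 - t) *\<^sub>R f + t *\<^sub>R g) (snd z)\<bar>
          \<le> (1 - t) * \<bar>f (fst z) - f (snd z)\<bar> + t * \<bar>g (fst z) - g (snd z)\<bar>" .
    qed simp
  qed (simp_all add: pointwise_lsc_dist)
qed (use assms in auto)

lemma ex_bcontfun:
  fixes f :: "'x::topological_space \<Rightarrow> real"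
  assumes "compact (UNIV :: 'x set)" "continuous_on UNIV f"
  obtains g where "apply_bcontfun g = f"
proof -
  have "bounded (range f)" using assms by (intro compact_imp_bounded compact_continuous_image)
  then have "f \<in> bcontfun" using assms(2) by (simp add: bcontfun_def)
  then show thesis using that by (metis bcontfunE)
qed

subsection \<open>Functions on metrizable fibers\<close>

text \<open>A stand-in for a countable base of the image of \<open>q\<close>: every open set that
  contains a fiber of \<open>q\<close> in \<open>D\<close> contains the support in \<open>D\<close>
  of a bump positive at the chosen point of this fiber. In contrast to a metric, this form glues
  over finitely many pieces by a mere union of families.\<close>

definition bump_family :: "'x::topological_space set \<Rightarrow> ('x \<Rightarrow> 'a) \<Rightarrow> ('x \<Rightarrow> real) set \<Rightarrow> bool"
  where "bump_family D q \<Phi> \<longleftrightarrow> countable \<Phi> \<and> (\<forall>\<phi>\<in>\<Phi>. continuous_on D \<phi> \<and> (\<forall>x. 0 \<le> \<phi> x)) \<and>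
    (\<forall>x0\<in>D. \<forall>G. open G \<longrightarrow> (\<forall>x\<in>D. q x = q x0 \<longrightarrow> x \<in> G) \<longrightarrow>
      (\<exists>\<phi>\<in>\<Phi>. 0 < \<phi> x0 \<and> (\<forall>x\<in>D. 0 < \<phi> x \<longrightarrow> x \<in> G)))"

lemma bump_familyI:
  assumes "countable \<Phi>" "\<And>\<phi>. \<phi> \<in> \<Phi> \<Longrightarrow> continuous_on D \<phi>" "\<And>\<phi> x. \<phi> \<in> \<Phi> \<Longrightarrow> 0 \<le> \<phi> x"
    and "\<And>x0 G. x0 \<in> D \<Longrightarrow> open G \<Longrightarrow> (\<And>x. x \<in> D \<Longrightarrow> q x = q x0 \<Longrightarrow> x \<in> G) \<Longrightarrow>
      \<exists>\<phi>\<in>\<Phi>. 0 < \<phi> x0 \<and> (\<forall>x\<in>D. 0 < \<phi> x \<longrightarrow> x \<in> G)"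
  shows "bump_family D q \<Phi>"
  using assms by (simp add: bump_family_def)

lemma bump_familyD:
  assumes "bump_family D q \<Phi>"
  shows "countable \<Phi>" "\<And>\<phi>. \<phi> \<in> \<Phi> \<Longrightarrow> continuous_on D \<phi>" "\<And>\<phi> x. \<phi> \<in> \<Phi> \<Longrightarrow> 0 \<le> \<phi> x"
    and "\<And>x0 G. x0 \<in> D \<Longrightarrow> open G \<Longrightarrow> (\<And>x. x \<in> D \<Longrightarrow> q x = q x0 \<Longrightarrow> x \<in> G) \<Longrightarrow>
      \<exists>\<phi>\<in>\<Phi>. 0 < \<phi> x0 \<and> (\<forall>x\<in>D. 0 < \<phi> x \<longrightarrow> x \<in> G)"
  using assms by (simp_all add: bump_family_def)

text \<open>The bumps are truncated distances to the points of finite nets of the compact image of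
  \<open>D\<close>, one net for each radius \<open>1 / (n + 1)\<close>.\<close>

lemma ex_countable_bumps:
  fixes D :: "'x::topological_space set" and q :: "'x \<Rightarrow> 'a"
  assumes D: "compact D" and M: "metrizable_space M" and q: "continuous_map (top_of_set D) M q"
  shows "\<exists>\<Phi>. bump_family D q \<Phi>"
proof -
  obtain S d where S: "Metric_space S d" and Meq: "M = Metric_space.mtopology S d"
    using M unfolding metrizable_space_def by blast
  interpret Metric_space S d by (rule S)
  have qS: "q x \<in> S" if "x \<in> D" for x
    using q that unfolding Meq continuous_map_def by (simp add: Pi_iff)
  have cont: "continuous_on D (\<lambda>x. d (q c) (q x))" if c: "c \<in> D" for c
  proof -
    have "continuous_map (top_of_set D) euclideanreal (\<lambda>x. mdist (metric (S, d)) (q c) (q x))"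
      using q qS[OF c] by (intro continuous_map_mdist) (simp_all add: Meq mtopology_of)
    then show ?thesis by simp
  qed
  define r where "r = (\<lambda>n::nat. 1 / (real n + 1))"
  have r: "0 < r n" for n by (simp add: r_def)
  have "\<exists>C. finite C \<and> C \<subseteq> D \<and> (\<forall>x\<in>D. \<exists>c\<in>C. d (q c) (q x) < r n)" for n
  proof -
    define B where "B = (\<lambda>c. {x \<in> D. d (q c) (q x) < r n})"
    have "openin (top_of_set D) (B c)" if "c \<in> D" for c
    proof -
      have "openin (top_of_set D) (D \<inter> (\<lambda>x. d (q c) (q x)) -` {..<r n})"
        using cont[OF that] by (rule continuous_openin_preimage_gen) simp
      moreover have "D \<inter> (\<lambda>x. d (q c) (q x)) -` {..<r n} = B c" by (auto simp: B_def)
      ultimately show ?thesis by simp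
    qed
    moreover have "D \<subseteq> \<Union>(B ` D)" using qS r[of n] by (auto simp: B_def)
    ultimately obtain \<F> where "\<F> \<subseteq> B ` D" "finite \<F>" "D \<subseteq> \<Union>\<F>"
      using D unfolding compact_eq_openin_cover by (metis (no_types, lifting) imageE)
    then obtain C where "C \<subseteq> D" "finite C" "D \<subseteq> \<Union>(B ` C)"
      by (metis finite_subset_image)
    then show ?thesis by (intro exI[of _ C]) (auto simp: B_def)
  qed
  then obtain C where C: "\<And>n. finite (C n)" "\<And>n. C n \<subseteq> D"
    "\<And>n x. x \<in> D \<Longrightarrow> \<exists>c\<in>C n. d (q c) (q x) < r n"
    by metis
  define bump where "bump = (\<lambda>n c x. max 0 (r n - d (q c) (q x)))"
  define \<Phi> where "\<Phi> = (\<Union>n. bump n ` C n)"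
  have "countable \<Phi>" using C(1) by (auto simp: \<Phi>_def intro: countable_finite)
  moreover have "continuous_on D \<phi>" if "\<phi> \<in> \<Phi>" for \<phi>
  proof -
    obtain n c where "c \<in> C n" "\<phi> = bump n c" using \<open>\<phi> \<in> \<Phi>\<close> by (auto simp: \<Phi>_def)
    moreover from this have "continuous_on D (\<lambda>x. d (q c) (q x))" using C(2) cont by blast
    ultimately show ?thesis by (auto simp: bump_def intro!: continuous_intros)
  qed
  moreover have "0 \<le> \<phi> x" if "\<phi> \<in> \<Phi>" for \<phi> x
    using that by (auto simp: \<Phi>_def bump_def)
  moreover have "\<exists>\<phi>\<in>\<Phi>. 0 < \<phi> x0 \<and> (\<forall>x\<in>D. 0 < \<phi> x \<longrightarrow> x \<in> G)"
    if x0: "x0 \<in> D" and G: "open G" "\<And>x. x \<in> D \<Longrightarrow> q x = q x0 \<Longrightarrow> x \<in> G" for x0 G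
  proof -
    \<comment> \<open>The distance to \<open>q x0\<close> attains its minimum on the compact set
      \<open>D - G\<close>, and it vanishes only on the fiber, which lies in
      \<open>G\<close>.\<close>
    have "\<exists>s>0. \<forall>x\<in>D - G. s \<le> d (q x0) (q x)"
    proof (cases "D - G = {}")
      case False
      have "compact (D - G)" using D G(1) by (rule compact_diff)
      moreover have "continuous_on (D - G) (\<lambda>x. d (q x0) (q x))"
        using cont[OF x0] by (rule continuous_on_subset) auto
      ultimately obtain y where y: "y \<in> D - G" "\<forall>x\<in>D - G. d (q x0) (q y) \<le> d (q x0) (q x)"
        using continuous_attains_inf[of "D - G"] False by blast
      then have "q y \<noteq> q x0" using G(2) by auto
      then have "0 < d (q x0) (q y)" using y(1) x0 qS by (simp add: mdist_pos_eq)
      then show ?thesis using y(2) by blast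
    qed (use zero_less_one in blast)
    then obtain s where s: "0 < s" "\<And>x. x \<in> D - G \<Longrightarrow> s \<le> d (q x0) (q x)" by blast
    \<comment> \<open>A bump of radius \<open>r n\<close> that is positive at \<open>x0\<close>
      reaches only points at distance below \<open>2 * r n\<close>, hence below \<open>s\<close>,
      from \<open>q x0\<close>.\<close>
    obtain n where n: "r n < s / 2"
      using reals_Archimedean[of "s / 2"] s(1) by (auto simp: r_def inverse_eq_divide add.commute)
    obtain c where c: "c \<in> C n" "d (q c) (q x0) < r n" using C(3)[OF x0] by blast
    have "x \<in> G" if x: "x \<in> D" "0 < bump n c x" for x
    proof (rule ccontr)
      assume "x \<notin> G"
      then have "s \<le> d (q x0) (q x)" using s x by simp
      also have "\<dots> \<le> d (q x0) (q c) + d (q c) (q x)"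
        using x0 x c C(2) qS by (intro triangle) auto
      also have "d (q x0) (q c) = d (q c) (q x0)" by (rule commute)
      also have "d (q c) (q x) < r n" using x(2) by (simp add: bump_def)
      finally show False using c(2) n by simp
    qed
    moreover have "bump n c \<in> \<Phi>" using c by (auto simp: \<Phi>_def)
    moreover have "0 < bump n c x0" using c by (simp add: bump_def)
    ultimately show ?thesis by blast
  qed
  ultimately have "bump_family D q \<Phi>" by (rule bump_familyI)
  then show ?thesis ..
qed

text \<open>By compactness maximum and minimum are attained, so their difference is still strictly
  below \<epsilon>, and the constants within \<open>\<epsilon> / 2\<close> of all values fill a
  nonempty open interval.\<close>

lemma ex_between:
  fixes g :: "'x::topological_space \<Rightarrow> real"
  assumes K: "compact K" "continuous_on K g" and osc: "\<And>x y. x \<in> K \<Longrightarrow> y \<in> K \<Longrightarrow> \<bar>g x - g y\<bar> < \<epsilon>"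
  shows "\<exists>c\<in>\<rat>. \<forall>x\<in>K. \<bar>g x - c\<bar> < \<epsilon> / 2"
proof (cases "K = {}")
  case False
  obtain a where a: "a \<in> K" "\<And>x. x \<in> K \<Longrightarrow> g a \<le> g x"
    using continuous_attains_inf[OF K(1) False K(2)] by blast
  obtain b where b: "b \<in> K" "\<And>x. x \<in> K \<Longrightarrow> g x \<le> g b"
    using continuous_attains_sup[OF K(1) False K(2)] by blast
  have "g b - \<epsilon> / 2 < g a + \<epsilon> / 2" using osc[OF b(1) a(1)] by linarith
  then obtain c where c: "c \<in> \<rat>" "g b - \<epsilon> / 2 < c" "c < g a + \<epsilon> / 2"
    using Rats_dense_in_real by blast
  have "\<bar>g x - c\<bar> < \<epsilon> / 2" if "x \<in> K" for x
    using a(2)[OF that] b(2)[OF that] c by linarith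
  then show ?thesis using c(1) by blast
qed (use Rats_0 in blast)

text \<open>On each fiber \<open>g\<close> is within \<open>\<epsilon> / 2\<close> of a rational
  constant, and this persists on the support of some bump. Finitely many bumps cover
  \<open>D\<close>; averaging the constants with these bumps as weights approximates
  \<open>g\<close>. Only finite subsets of \<open>\<Phi> \<times> \<rat>\<close> occur, so the
  family depends neither on \<open>g\<close> nor on \<epsilon>.\<close>

lemma ex_countable_approximants:
  fixes D :: "'x::topological_space set" and q :: "'x \<Rightarrow> 'a"
  assumes cpt: "compact (UNIV :: 'x set)" and Hd: "Hausdorff_space (euclidean :: 'x topology)"
    and D: "closed D" and fibers: "\<And>x0. x0 \<in> D \<Longrightarrow> closed {x \<in> D. q x = q x0}"
    and bumps: "bump_family D q \<Phi>"
  shows "\<exists>V. countable V \<and> (\<forall>(g :: 'x \<Rightarrow>\<^sub>C real) \<epsilon>. (\<forall>x\<in>D. \<forall>y\<in>D. q x = q y \<longrightarrow> \<bar>g x - g y\<bar> < \<epsilon>) \<longrightarrow>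
    (\<exists>v\<in>V. \<forall>x\<in>D. \<bar>g x - apply_bcontfun v x\<bar> < \<epsilon> / 2))"
proof -
  note \<Phi> = bump_familyD[OF bumps]
  have cptD: "compact D" using cpt D by (metis compact_Int_closed inf_top_left)
  have normal: "normal_space (euclidean :: 'x topology)"
    using cpt Hd by (intro compact_Hausdorff_or_regular_imp_normal_space) (auto simp: compact_space_def)
  define mean where "mean = (\<lambda>(R :: (('x \<Rightarrow> real) \<times> real) set) x. (\<Sum>(\<phi>, c)\<in>R. \<phi> x * c) / (\<Sum>(\<phi>, c)\<in>R. \<phi> x))"
  define \<R> where "\<R> = {R. R \<subseteq> \<Phi> \<times> (\<rat> :: real set) \<and> finite R}"
  have "countable \<R>"
    unfolding \<R>_def using \<Phi>(1) countable_rat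
    by (metis (no_types, lifting) Collect_cong countable_Collect_finite_subset countable_SIGMA conj_commute)
  \<comment> \<open>For sets \<open>R\<close> whose mean has no continuous extension the choice is
    arbitrary; such members do no harm, since only countability of \<open>V\<close> matters
    there.\<close>
  define V where "V = (\<lambda>R. SOME v. \<forall>x\<in>D. apply_bcontfun v x = mean R x) ` \<R>"
  have "\<exists>v\<in>V. \<forall>x\<in>D. \<bar>g x - apply_bcontfun v x\<bar> < \<epsilon> / 2"
    if g: "\<And>x y. x \<in> D \<Longrightarrow> y \<in> D \<Longrightarrow> q x = q y \<Longrightarrow> \<bar>g x - g y\<bar> < \<epsilon>" for g :: "'x \<Rightarrow>\<^sub>C real" and \<epsilon>
  proof -
    have "\<exists>\<phi> c. \<phi> \<in> \<Phi> \<and> c \<in> \<rat> \<and> 0 < \<phi> x0 \<and> (\<forall>x\<in>D. 0 < \<phi> x \<longrightarrow> \<bar>g x - c\<bar> < \<epsilon> / 2)" if x0: "x0 \<in> D" for x0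
    proof -
      have "compact {x \<in> D. q x = q x0}"
        using cpt fibers[OF x0] by (metis compact_Int_closed inf_top_left)
      then obtain c where c: "c \<in> \<rat>" "\<forall>x\<in>{x \<in> D. q x = q x0}. \<bar>g x - c\<bar> < \<epsilon> / 2"
        using ex_between[of "{x \<in> D. q x = q x0}" g \<epsilon>] g by auto
      have "open {x. \<bar>g x - c\<bar> < \<epsilon> / 2}" by (intro open_Collect_less continuous_intros) auto
      from \<Phi>(4)[OF x0 this] c show ?thesis by auto
    qed
    then obtain \<phi> c where *: "\<And>x0. x0 \<in> D \<Longrightarrow> \<phi> x0 \<in> \<Phi>" "\<And>x0. x0 \<in> D \<Longrightarrow> c x0 \<in> \<rat>"
      "\<And>x0. x0 \<in> D \<Longrightarrow> 0 < \<phi> x0 x0"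
      "\<And>x0 x. x0 \<in> D \<Longrightarrow> x \<in> D \<Longrightarrow> 0 < \<phi> x0 x \<Longrightarrow> \<bar>g x - c x0\<bar> < \<epsilon> / 2"
      by metis
    define B where "B = (\<lambda>x0. {x \<in> D. 0 < \<phi> x0 x})"
    have "openin (top_of_set D) (B x0)" if "x0 \<in> D" for x0
    proof -
      have "openin (top_of_set D) (D \<inter> \<phi> x0 -` {0<..})"
        using \<Phi>(2)[OF *(1)[OF that]] by (rule continuous_openin_preimage_gen) simp
      moreover have "D \<inter> \<phi> x0 -` {0<..} = B x0" by (auto simp: B_def)
      ultimately show ?thesis by simp
    qed
    moreover have "D \<subseteq> \<Union>(B ` D)" using *(3) by (auto simp: B_def)
    ultimately obtain \<F> where "\<F> \<subseteq> B ` D" "finite \<F>" "D \<subseteq> \<Union>\<F>"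
      using cptD unfolding compact_eq_openin_cover by (metis (no_types, lifting) imageE)
    then obtain T where T: "T \<subseteq> D" "finite T" "D \<subseteq> \<Union>(B ` T)"
      by (metis finite_subset_image)
    define R where "R = (\<lambda>x0. (\<phi> x0, c x0)) ` T"
    have fin: "finite R" and R: "R \<in> \<R>" using T *(1,2) by (auto simp: R_def \<R>_def)
    have R\<Phi>: "\<psi> \<in> \<Phi>" if "(\<psi>, a) \<in> R" for \<psi> a using that R by (auto simp: \<R>_def)
    have near: "\<bar>g x - a\<bar> < \<epsilon> / 2" if "(\<psi>, a) \<in> R" "x \<in> D" "0 < \<psi> x" for \<psi> a x
      using that *(4) T(1) by (auto simp: R_def)
    have some_pos: "\<exists>(\<psi>, a)\<in>R. 0 < \<psi> x" if "x \<in> D" for x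
      using that T(3) by (force simp: R_def B_def)
    have pos: "0 < (\<Sum>(\<psi>, a)\<in>R. \<psi> x)" if x: "x \<in> D" for x
    proof -
      obtain \<psi> a where "(\<psi>, a) \<in> R" "0 < \<psi> x" using some_pos[OF x] by blast
      then show ?thesis
        using fin R\<Phi> \<Phi>(3) by (intro sum_pos2[of R "(\<psi>, a)"]) auto
    qed
    have "continuous_on D (mean R)"
      unfolding mean_def using R\<Phi> \<Phi>(2) pos
      by (intro continuous_on_divide continuous_on_sum) (auto intro!: continuous_intros simp: less_imp_neq[symmetric] split: prod.splits)
    then have "continuous_map (subtopology euclidean D) euclideanreal (mean R)" by simp
    then obtain h where h: "continuous_map euclidean euclideanreal h" "\<And>x. x \<in> D \<Longrightarrow> h x = mean R x"
      using Tietze_extension_realinterval[OF normal, of D UNIV "mean R"] D by auto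
    then obtain v0 where "apply_bcontfun v0 = h" using ex_bcontfun[OF cpt, of h] by auto
    then have "\<forall>x\<in>D. apply_bcontfun v0 x = mean R x" using h(2) by simp
    then have v: "\<forall>x\<in>D. apply_bcontfun (SOME v. \<forall>x\<in>D. apply_bcontfun v x = mean R x) x = mean R x"
      by (rule someI)
    have "\<bar>g x - mean R x\<bar> < \<epsilon> / 2" if x: "x \<in> D" for x
    proof -
      let ?s = "\<Sum>(\<psi>, a)\<in>R. \<psi> x"
      have "g x - mean R x = (g x * ?s - (\<Sum>(\<psi>, a)\<in>R. \<psi> x * a)) / ?s"
        using pos[OF x] by (simp add: mean_def diff_divide_distrib)
      also have "g x * ?s - (\<Sum>(\<psi>, a)\<in>R. \<psi> x * a) = (\<Sum>(\<psi>, a)\<in>R. \<psi> x * (g x - a))"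
        by (simp add: sum_distrib_left sum_subtractf[symmetric] case_prod_unfold algebra_simps)
      finally have eq: "\<bar>g x - mean R x\<bar> = \<bar>\<Sum>(\<psi>, a)\<in>R. \<psi> x * (g x - a)\<bar> / ?s"
        using pos[OF x] by simp
      have "\<bar>\<Sum>(\<psi>, a)\<in>R. \<psi> x * (g x - a)\<bar> \<le> (\<Sum>(\<psi>, a)\<in>R. \<psi> x * \<bar>g x - a\<bar>)"
        using \<Phi>(3) R\<Phi> by (intro order_trans[OF sum_abs] sum_mono) (auto simp: abs_mult)
      \<comment> \<open>Strict because at least one weight is positive at \<open>x\<close>; terms of
        weight 0 contribute equality.\<close>
      also have "\<dots> < (\<Sum>(\<psi>, a)\<in>R. \<psi> x * (\<epsilon> / 2))"
      proof (rule sum_strict_mono_ex1[OF fin])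
        show "\<forall>z\<in>R. (case z of (\<psi>, a) \<Rightarrow> \<psi> x * \<bar>g x - a\<bar>) \<le> (case z of (\<psi>, a) \<Rightarrow> \<psi> x * (\<epsilon> / 2))"
        proof clarify
          fix \<psi> a assume z: "(\<psi>, a) \<in> R"
          then have "0 \<le> \<psi> x" using \<Phi>(3) R\<Phi> by blast
          then show "\<psi> x * \<bar>g x - a\<bar> \<le> \<psi> x * (\<epsilon> / 2)"
            using near[OF z x] by (cases "\<psi> x = 0") (auto intro!: mult_left_mono)
        qed
        obtain \<psi> a where "(\<psi>, a) \<in> R" "0 < \<psi> x" using some_pos[OF x] by blast
        then show "\<exists>z\<in>R. (case z of (\<psi>, a) \<Rightarrow> \<psi> x * \<bar>g x - a\<bar>) < (case z of (\<psi>, a) \<Rightarrow> \<psi> x * (\<epsilon> / 2))"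
          using near[OF _ x] by (intro bexI[of _ "(\<psi>, a)"]) (auto intro!: mult_strict_left_mono)
      qed
      also have "\<dots> = ?s * (\<epsilon> / 2)"
        by (simp add: sum_distrib_right case_prod_unfold)
      finally show ?thesis using pos[OF x] by (simp add: eq pos_divide_less_eq mult.commute)
    qed
    then show ?thesis
      using v R unfolding V_def by (intro bexI[OF _ imageI[OF R]]) simp
  qed
  then show ?thesis
    using \<open>countable \<R>\<close> by (intro exI[of _ V]) (auto simp: V_def)
qed

section \<open>A finiteness criterion and an exchange inequality for finite sums\<close>

lemma finite_if_locally_subsingleton:
  assumes K: "compactin T K" and B: "B \<subseteq> K"
    and local: "\<And>y. y \<in> K \<Longrightarrow> \<exists>V. openin T V \<and> y \<in> V \<and> B \<inter> V \<subseteq> {y}"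
  shows "finite B"
proof (rule ccontr)
  assume "infinite B"
  then obtain y where y: "y \<in> K" "y \<in> T derived_set_of B"
    using compactin_imp_Bolzano_Weierstrass[OF K, of B] B by blast
  from local[OF y(1)] obtain V where "openin T V" "y \<in> V" "B \<inter> V \<subseteq> {y}" by blast
  then show False using y(2) unfolding in_derived_set_of by blast
qed

text \<open>Passing from \<open>A\<close> to \<open>B\<close> replaces the points of
  \<open>A - B\<close> by at most as many points of \<open>B - A\<close>. Each replacement loses at
  least \<open>\<epsilon> - \<theta>\<close>, and at least one point is lost. This is the margin by
  which the set of large oscillation is the unique maximizer.\<close>

lemma sum_add_gap_le:
  fixes \<phi> :: "'b \<Rightarrow> real"
  assumes fin: "finite A" "finite B" and card: "card B \<le> card A" "B \<noteq> A"
    and \<theta>: "0 \<le> \<theta>" "\<theta> \<le> \<epsilon>" and ge: "\<And>t. t \<in> A \<Longrightarrow> \<epsilon> \<le> \<phi> t" and le: "\<And>t. t \<in> B - A \<Longrightarrow> \<phi> t \<le> \<theta>"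
  shows "sum \<phi> B + (\<epsilon> - \<theta>) \<le> sum \<phi> A"
proof -
  let ?n = "card (A - B)"
  have card_eq: "card A = card (A \<inter> B) + ?n" "card B = card (A \<inter> B) + card (B - A)"
    using card_Int_Diff[OF fin(1), of B] card_Int_Diff[OF fin(2), of A] by (simp_all add: Int_commute)
  have "A - B \<noteq> {}" using card card_subset_eq[OF fin(2), of A] card_mono[OF fin(2), of A] by auto
  then have n: "1 \<le> ?n" using fin by (simp add: card_gt_0_iff Suc_leI)
  have "sum \<phi> B = sum \<phi> (A \<inter> B) + sum \<phi> (B - A)"
    using fin sum.Int_Diff[of B \<phi> A] by (simp add: Int_commute)
  moreover have "sum \<phi> A = sum \<phi> (A \<inter> B) + sum \<phi> (A - B)"
    using fin sum.Int_Diff[of A \<phi> B] by simp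
  moreover have "sum \<phi> (B - A) \<le> real (card (B - A)) * \<theta>"
    using le by (intro sum_bounded_above)
  moreover have "\<dots> \<le> real ?n * \<theta>"
    using card card_eq \<theta> by (intro mult_right_mono) auto
  moreover have "real ?n * \<epsilon> \<le> sum \<phi> (A - B)"
    using ge by (intro sum_bounded_below) auto
  moreover have "1 * (\<epsilon> - \<theta>) \<le> real ?n * (\<epsilon> - \<theta>)"
    using n \<theta> by (intro mult_right_mono) auto
  ultimately show ?thesis by (simp add: algebra_simps)
qed

subsection \<open>Limits of F-decomposable systems\<close>

text \<open>The fixed homeomorphism \<open>h\<close> turns the projections of the limit into maps on
  the type \<open>'x\<close>, so that all analysis takes place in
  \<open>'x \<Rightarrow>\<^sub>C real\<close>.\<close>

locale F_decomposable_limit =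
  fixes \<gamma> :: "'i::wellorder"
    and Y :: "'i \<Rightarrow> 'a topology"
    and \<pi> :: "'i \<Rightarrow> 'i \<Rightarrow> 'a \<Rightarrow> 'a"
    and h :: "'x::topological_space \<Rightarrow> 'i \<Rightarrow> 'a"
  assumes countable_length: "countable {..<\<gamma>}"
    and F_decomposable: "F_decomposable \<gamma> Y \<pi>"
    and metrizable_fibers: "metrizable_neighboring_fibers \<gamma> Y \<pi>"
    and homeomorphic: "homeomorphic_map euclidean (inverse_limit \<gamma> Y \<pi>) h"
begin

definition proj :: "'i \<Rightarrow> 'x \<Rightarrow> 'a"
  where "proj \<alpha> x = h x \<alpha>"

lemma system: "inverse_system \<gamma> Y \<pi>" "continuous_system \<gamma> Y \<pi>"
  "\<And>\<alpha>. \<alpha> < \<gamma> \<Longrightarrow> compact_space (Y \<alpha>)" "\<And>\<alpha>. \<alpha> < \<gamma> \<Longrightarrow> Hausdorff_space (Y \<alpha>)"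
  "\<exists>\<alpha><\<gamma>. zero_ordinal \<alpha> \<and> (\<exists>a. topspace (Y \<alpha>) = {a})"
  using F_decomposable by (auto simp: F_decomposable_def standard_system_def)

lemma h_limit: "h x \<in> topspace (inverse_limit \<gamma> Y \<pi>)"
  using homeomorphic_imp_surjective_map[OF homeomorphic] by auto

lemma proj_in: "\<alpha> < \<gamma> \<Longrightarrow> proj \<alpha> x \<in> topspace (Y \<alpha>)"
  using h_limit[of x] by (auto simp: inverse_limit_def proj_def PiE_def Pi_iff)

lemma bond: "\<alpha> \<le> \<beta> \<Longrightarrow> \<beta> < \<gamma> \<Longrightarrow> \<pi> \<alpha> \<beta> (proj \<beta> x) = proj \<alpha> x"
  using h_limit[of x] by (auto simp: inverse_limit_def proj_def)

lemma proj_mono: "\<alpha> \<le> \<beta> \<Longrightarrow> \<beta> < \<gamma> \<Longrightarrow> proj \<beta> x = proj \<beta> y \<Longrightarrow> proj \<alpha> x = proj \<alpha> y"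
  by (metis bond)

lemma continuous_proj: "\<alpha> < \<gamma> \<Longrightarrow> continuous_map euclidean (Y \<alpha>) (proj \<alpha>)"
proof -
  assume "\<alpha> < \<gamma>"
  then have "continuous_map (inverse_limit \<gamma> Y \<pi>) (Y \<alpha>) (\<lambda>z. z \<alpha>)"
    unfolding inverse_limit_def by (intro continuous_map_from_subtopology continuous_map_product_projection) simp
  from continuous_map_compose[OF homeomorphic_imp_continuous_map[OF homeomorphic] this]
  show ?thesis by (simp add: comp_def proj_def[abs_def])
qed

lemma proj_zero:
  assumes "zero_ordinal \<alpha>" "\<alpha> < \<gamma>"
  shows "proj \<alpha> x = proj \<alpha> y"
proof -
  obtain \<alpha>' a where "\<alpha>' < \<gamma>" "zero_ordinal \<alpha>'" "topspace (Y \<alpha>') = {a}" using system(5) by blast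
  moreover from this have "\<alpha>' = \<alpha>" using assms by (intro antisym) (auto simp: zero_ordinal_def)
  ultimately show ?thesis using proj_in[of \<alpha> x] proj_in[of \<alpha> y] by auto
qed

lemma proj_limit:
  assumes "limit_ordinal \<alpha>" "\<alpha> < \<gamma>" and eq: "\<And>\<beta>. \<beta> < \<alpha> \<Longrightarrow> proj \<beta> x = proj \<beta> y"
  shows "proj \<alpha> x = proj \<alpha> y"
proof -
  have "homeomorphic_map (Y \<alpha>) (inverse_limit \<alpha> Y \<pi>) (\<lambda>x. \<lambda>\<beta>\<in>{..<\<alpha>}. \<pi> \<beta> \<alpha> x)"
    using system(2) assms by (auto simp: continuous_system_def)
  then have "inj_on (\<lambda>x. \<lambda>\<beta>\<in>{..<\<alpha>}. \<pi> \<beta> \<alpha> x) (topspace (Y \<alpha>))"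
    by (rule homeomorphic_imp_injective_map)
  moreover have "(\<lambda>\<beta>\<in>{..<\<alpha>}. \<pi> \<beta> \<alpha> (proj \<alpha> x)) = (\<lambda>\<beta>\<in>{..<\<alpha>}. \<pi> \<beta> \<alpha> (proj \<alpha> y))"
    using assms bond by (intro restrict_ext) auto
  ultimately show ?thesis using proj_in[OF assms(2)] by (auto simp: inj_on_def)
qed

lemma proj_separates:
  assumes "\<And>\<beta>. \<beta> < \<gamma> \<Longrightarrow> proj \<beta> x = proj \<beta> y"
  shows "x = y"
proof -
  have ext: "h z \<in> extensional {..<\<gamma>}" for z
    using h_limit[of z] by (auto simp: inverse_limit_def PiE_def)
  have "h x = h y"
    using assms by (intro extensionalityI[OF ext ext]) (auto simp: proj_def)
  then show ?thesis
    using homeomorphic_imp_injective_map[OF homeomorphic] by (auto simp: inj_on_def)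
qed

lemma Hausdorff: "Hausdorff_space (euclidean :: 'x topology)"
proof -
  have "Hausdorff_space (inverse_limit \<gamma> Y \<pi>)"
    unfolding inverse_limit_def using system(4)
    by (intro Hausdorff_space_subtopology) (simp add: Hausdorff_space_product_topology)
  then show ?thesis
    using homeomorphic homeomorphic_Hausdorff_space homeomorphic_map_imp_homeomorphic_space by blast
qed

lemma compact: "compact (UNIV :: 'x set)"
proof -
  let ?P = "product_topology Y {..<\<gamma>}"
  define J where "J = {(\<alpha>, \<beta>). \<alpha> \<le> \<beta> \<and> \<beta> < \<gamma>}"
  define E where "E = (\<lambda>(\<alpha>, \<beta>). {z \<in> topspace ?P. \<pi> \<alpha> \<beta> (z \<beta>) = z \<alpha>})"
  have "closedin ?P (E j)" if "j \<in> J" for j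
  proof -
    obtain \<alpha> \<beta> where j: "j = (\<alpha>, \<beta>)" "\<alpha> \<le> \<beta>" "\<beta> < \<gamma>" using \<open>j \<in> J\<close> by (auto simp: J_def)
    have "continuous_map (Y \<beta>) (Y \<alpha>) (\<pi> \<alpha> \<beta>)"
      using system(1) j by (auto simp: inverse_system_def)
    then have 1: "continuous_map ?P (Y \<alpha>) (\<pi> \<alpha> \<beta> \<circ> (\<lambda>z. z \<beta>))"
      using j by (intro continuous_map_compose[OF continuous_map_product_projection]) auto
    have 2: "continuous_map ?P (Y \<alpha>) (\<lambda>z. z \<alpha>)"
      using j by (intro continuous_map_product_projection) auto
    have "Hausdorff_space (Y \<alpha>)" using system(4)[of \<alpha>] j by simp
    from closedin_continuous_maps_eq[OF this 1 2] show ?thesis by (simp add: E_def j)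
  qed
  \<comment> \<open>The limit is an intersection of equalizers inside the product; the index set is
    nonempty because a system has a level 0.\<close>
  moreover have J: "J \<noteq> {}" using system(5) by (auto simp: J_def)
  ultimately have "closedin ?P (\<Inter>(E ` J))" by (intro closedin_Inter) auto
  moreover have "compact_space ?P" using system(3) by (simp add: compact_space_product_topology)
  ultimately have "compact_space (subtopology ?P (\<Inter>(E ` J)))"
    using closedin_compact_space compact_space_subtopology by blast
  moreover have "topspace ?P \<inter> {z. \<forall>\<alpha> \<beta>. \<alpha> \<le> \<beta> \<and> \<beta> < \<gamma> \<longrightarrow> \<pi> \<alpha> \<beta> (z \<beta>) = z \<alpha>} = \<Inter>(E ` J)"
    using J by (auto simp: E_def J_def)
  then have "subtopology ?P (topspace ?P \<inter> {z. \<forall>\<alpha> \<beta>. \<alpha> \<le> \<beta> \<and> \<beta> < \<gamma> \<longrightarrow> \<pi> \<alpha> \<beta> (z \<beta>) = z \<alpha>}) =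
      subtopology ?P (\<Inter>(E ` J))" by (rule arg_cong)
  then have "inverse_limit \<gamma> Y \<pi> = subtopology ?P (\<Inter>(E ` J))"
    unfolding inverse_limit_def by (simp only: subtopology_restrict)
  ultimately have "compact_space (inverse_limit \<gamma> Y \<pi>)" by simp
  then have "compact_space (euclidean :: 'x topology)"
    using homeomorphic homeomorphic_compact_space homeomorphic_map_imp_homeomorphic_space by blast
  then show ?thesis by (simp add: compact_space_def)
qed

lemma closed_eq:
  assumes "continuous_map (euclidean :: 'z::topological_space topology) (Y \<alpha>) f"
    "continuous_map euclidean (Y \<alpha>) g" "\<alpha> < \<gamma>"
  shows "closed {z. f z = g z}"
  using closedin_continuous_maps_eq[OF system(4)[OF assms(3)] assms(1,2)] by simp

lemma closed_fiber: "\<alpha> < \<gamma> \<Longrightarrow> closed (proj \<alpha> -` {t})"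
proof (cases "t \<in> range (proj \<alpha>)")
  case True
  assume \<alpha>: "\<alpha> < \<gamma>"
  have "t \<in> topspace (Y \<alpha>)" using True proj_in[OF \<alpha>] by auto
  then have "closed {x. proj \<alpha> x = t}"
    using \<alpha> continuous_proj[OF \<alpha>] by (intro closed_eq[of \<alpha>]) auto
  then show ?thesis by (simp add: vimage_def)
next
  case False
  then have "proj \<alpha> -` {t} = {}" by auto
  then show ?thesis by simp
qed

section \<open>Functions of small oscillation on the fibers of a level\<close>

text \<open>The strict bound makes its violation by a pair of points a closed condition, as
  compactness arguments require.\<close>

definition small_osc :: "real \<Rightarrow> 'i \<Rightarrow> ('x \<Rightarrow>\<^sub>C real) set"
  where "small_osc \<epsilon> \<alpha> = {f. \<forall>x y. proj \<alpha> x = proj \<alpha> y \<longrightarrow> \<bar>apply_bcontfun f x - apply_bcontfun f y\<bar> < \<epsilon>}"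

lemma small_osc_D: "f \<in> small_osc \<epsilon> \<alpha> \<Longrightarrow> proj \<alpha> x = proj \<alpha> y \<Longrightarrow> \<bar>apply_bcontfun f x - apply_bcontfun f y\<bar> < \<epsilon>"
  by (simp add: small_osc_def)

lemma small_osc_mono: "\<alpha> \<le> \<beta> \<Longrightarrow> \<beta> < \<gamma> \<Longrightarrow> small_osc \<epsilon> \<alpha> \<subseteq> small_osc \<epsilon> \<beta>"
  by (auto simp: small_osc_def dest: proj_mono[of \<alpha> \<beta>])

text \<open>The pairs violating the bound form closed sets that shrink as the level rises, because
  fibers become finer. If none were empty, compactness would give one pair violating the bound at
  all levels of \<open>J\<close>, against \<open>sep\<close>.\<close>

lemma ex_small_osc:
  fixes f :: "'x \<Rightarrow>\<^sub>C real"
  assumes J: "J \<noteq> {}" "J \<subseteq> {..<\<gamma>}"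
    and sep: "\<And>x y. (\<And>\<beta>. \<beta> \<in> J \<Longrightarrow> proj \<beta> x = proj \<beta> y) \<Longrightarrow> \<bar>apply_bcontfun f x - apply_bcontfun f y\<bar> < \<epsilon>"
  shows "\<exists>\<beta>\<in>J. f \<in> small_osc \<epsilon> \<beta>"
proof (rule ccontr)
  assume neg: "\<not> ?thesis"
  define E where "E = (\<lambda>\<beta>. {z :: 'x \<times> 'x. proj \<beta> (fst z) = proj \<beta> (snd z)} \<inter>
    {z. \<epsilon> \<le> \<bar>apply_bcontfun f (fst z) - apply_bcontfun f (snd z)\<bar>})"
  have "UNIV \<inter> \<Inter>(E ` J) \<noteq> {}"
  proof (rule compact_imp_fip_image)
    show "compact (UNIV :: ('x \<times> 'x) set)"
      using compact_Times[OF compact compact] by simp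
    show "closed (E \<beta>)" if "\<beta> \<in> J" for \<beta>
    proof -
      have \<beta>: "\<beta> < \<gamma>" using that J by auto
      have "continuous_map euclidean (Y \<beta>) (proj \<beta> \<circ> (fst :: 'x \<times> 'x \<Rightarrow> 'x))"
        "continuous_map euclidean (Y \<beta>) (proj \<beta> \<circ> (snd :: 'x \<times> 'x \<Rightarrow> 'x))"
        using continuous_proj[OF \<beta>]
        by (auto intro!: continuous_map_compose[of _ euclidean] continuous_on_fst continuous_on_snd)
      then have "closed {z :: 'x \<times> 'x. (proj \<beta> \<circ> fst) z = (proj \<beta> \<circ> snd) z}"
        using \<beta> by (rule closed_eq)
      moreover have "continuous_on UNIV (\<lambda>z :: 'x \<times> 'x. apply_bcontfun f (fst z))"
        "continuous_on UNIV (\<lambda>z :: 'x \<times> 'x. apply_bcontfun f (snd z))"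
        by (auto intro!: continuous_on_compose2[OF continuous_on_apply_bcontfun[of UNIV f]] continuous_on_fst continuous_on_snd)
      then have "closed {z :: 'x \<times> 'x. \<epsilon> \<le> \<bar>apply_bcontfun f (fst z) - apply_bcontfun f (snd z)\<bar>}"
        by (intro closed_Collect_le continuous_on_const continuous_on_rabs continuous_on_diff)
      ultimately show ?thesis unfolding E_def by (auto intro: closed_Int)
    qed
    fix I assume I: "finite I" "I \<subseteq> J"
    show "UNIV \<inter> \<Inter>(E ` I) \<noteq> {}"
    proof (cases "I = {}")
      case False
      then have Max: "Max I \<in> J" using I Max_in by blast
      then obtain x y where "proj (Max I) x = proj (Max I) y" "\<epsilon> \<le> \<bar>apply_bcontfun f x - apply_bcontfun f y\<bar>"
        using neg by (auto simp: small_osc_def not_less)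
      then have "(x, y) \<in> E \<beta>" if "\<beta> \<in> I" for \<beta>
        using proj_mono[of \<beta> "Max I" x y] Max_ge[OF I(1) that] Max J by (auto simp: E_def)
      then show ?thesis by blast
    qed simp
  qed
  then obtain x y where "\<And>\<beta>. \<beta> \<in> J \<Longrightarrow> (x, y) \<in> E \<beta>" by auto
  then have eq: "\<And>\<beta>. \<beta> \<in> J \<Longrightarrow> proj \<beta> x = proj \<beta> y" and ge: "\<epsilon> \<le> \<bar>apply_bcontfun f x - apply_bcontfun f y\<bar>"
    using J(1) by (auto simp: E_def)
  have "\<bar>apply_bcontfun f x - apply_bcontfun f y\<bar> < \<epsilon>" by (rule sep) (rule eq)
  then show False using ge by simp
qed

lemma ex_small_osc_index:
  assumes "0 < \<epsilon>"
  shows "\<exists>\<beta><\<gamma>. f \<in> small_osc \<epsilon> \<beta>"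
proof -
  have "\<exists>\<beta>\<in>{..<\<gamma>}. f \<in> small_osc \<epsilon> \<beta>"
  proof (rule ex_small_osc)
    fix x y assume "\<And>\<beta>. \<beta> \<in> {..<\<gamma>} \<Longrightarrow> proj \<beta> x = proj \<beta> y"
    then have "x = y" by (intro proj_separates) simp
    then show "\<bar>apply_bcontfun f x - apply_bcontfun f y\<bar> < \<epsilon>" using assms by simp
  qed (use system(5) in auto)
  then show ?thesis by auto
qed

lemma ex_small_osc_below_limit:
  assumes \<alpha>: "limit_ordinal \<alpha>" "\<alpha> < \<gamma>" and f: "f \<in> small_osc \<epsilon> \<alpha>"
  shows "\<exists>\<beta><\<alpha>. f \<in> small_osc \<epsilon> \<beta>"
proof -
  have "{..<\<alpha>} \<noteq> {}"
    using \<alpha>(1) by (force simp: limit_ordinal_def zero_ordinal_def not_le)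
  moreover have "{..<\<alpha>} \<subseteq> {..<\<gamma>}" using \<alpha>(2) by auto
  ultimately have "\<exists>\<beta>\<in>{..<\<alpha>}. f \<in> small_osc \<epsilon> \<beta>"
  proof (rule ex_small_osc)
    fix x y assume "\<And>\<beta>. \<beta> \<in> {..<\<alpha>} \<Longrightarrow> proj \<beta> x = proj \<beta> y"
    then have "proj \<alpha> x = proj \<alpha> y" by (intro proj_limit[OF \<alpha>]) simp
    then show "\<bar>apply_bcontfun f x - apply_bcontfun f y\<bar> < \<epsilon>" by (rule small_osc_D[OF f])
  qed
  then show ?thesis by auto
qed

text \<open>A projection from a compact space to a Hausdorff space is closed, so removing the image
  of the complement of \<open>G\<close> leaves an open neighborhood of \<open>z\<close>. The fiber
  over \<open>z\<close> may be empty.\<close>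

lemma tube:
  assumes \<beta>: "\<beta> < \<gamma>" and z: "z \<in> topspace (Y \<beta>)" and G: "open G" "proj \<beta> -` {z} \<subseteq> G"
  shows "\<exists>U. openin (Y \<beta>) U \<and> z \<in> U \<and> proj \<beta> -` U \<subseteq> G"
proof (intro exI conjI)
  have "compact (- G)"
    using compact G(1) by (metis Compl_eq_Diff_UNIV compact_diff)
  then have "compactin (Y \<beta>) (proj \<beta> ` (- G))"
    using image_compactin[OF _ continuous_proj[OF \<beta>]] by simp
  then have "closedin (Y \<beta>) (proj \<beta> ` (- G))"
    using system(4)[OF \<beta>] by (rule compactin_imp_closedin[rotated])
  then show "openin (Y \<beta>) (topspace (Y \<beta>) - proj \<beta> ` (- G))" by blast
qed (use z G(2) in auto)

text \<open>
  Passing to a level \<open>\<beta>\<close> on which \<open>f\<close> nearly factors, this is the only use of full closedness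
  of the mapping from level \<open>\<beta>\<close> to level \<open>\<alpha>\<close>.
\<close>

lemma finite_large_osc:
  fixes f :: "'x \<Rightarrow>\<^sub>C real"
  assumes \<alpha>: "\<alpha> < \<gamma>" and \<delta>: "0 < \<delta>"
  shows "finite {t. \<exists>x y. proj \<alpha> x = t \<and> proj \<alpha> y = t \<and> \<delta> \<le> \<bar>apply_bcontfun f x - apply_bcontfun f y\<bar>}"
    (is "finite ?bad")
proof -
  \<comment> \<open>The fiber of \<open>x0\<close> at such a level lies where \<open>f\<close>
    differs from \<open>f x0\<close> by less than \<open>\<delta> / 3\<close>; any two points there
    have values closer than \<delta>.\<close>
  obtain \<beta>0 where \<beta>0: "\<beta>0 < \<gamma>" "f \<in> small_osc (\<delta> / 3) \<beta>0" using ex_small_osc_index[of "\<delta> / 3"] \<delta> by auto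
  define \<beta> where "\<beta> = max \<alpha> \<beta>0"
  have \<beta>: "\<alpha> \<le> \<beta>" "\<beta> < \<gamma>" and f: "f \<in> small_osc (\<delta> / 3) \<beta>"
    using \<alpha> \<beta>0 small_osc_mono[of \<beta>0 \<beta>] by (auto simp: \<beta>_def)
  define small where "small = (\<lambda>U. \<forall>x x'. proj \<beta> x \<in> U \<longrightarrow> proj \<beta> x' \<in> U \<longrightarrow> \<bar>apply_bcontfun f x - apply_bcontfun f x'\<bar> < \<delta>)"
  have small_nhd: "\<exists>U. openin (Y \<beta>) U \<and> z \<in> U \<and> small U" if z: "z \<in> topspace (Y \<beta>)" for z
  proof -
    have "\<exists>G. open G \<and> proj \<beta> -` {z} \<subseteq> G \<and> (\<forall>x\<in>G. \<forall>x'\<in>G. \<bar>apply_bcontfun f x - apply_bcontfun f x'\<bar> < \<delta>)"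
    proof (cases "z \<in> range (proj \<beta>)")
      case True
      then obtain x0 where x0: "z = proj \<beta> x0" by auto
      define G where "G = {x. \<bar>apply_bcontfun f x - apply_bcontfun f x0\<bar> < \<delta> / 3}"
      have "open G" unfolding G_def by (intro open_Collect_less continuous_intros) auto
      moreover have "proj \<beta> -` {z} \<subseteq> G" using small_osc_D[OF f] by (auto simp: G_def x0)
      moreover have "\<bar>apply_bcontfun f x - apply_bcontfun f x'\<bar> < \<delta>" if "x \<in> G" "x' \<in> G" for x x'
      proof -
        have "\<bar>apply_bcontfun f x - apply_bcontfun f x0\<bar> < \<delta> / 3" "\<bar>apply_bcontfun f x' - apply_bcontfun f x0\<bar> < \<delta> / 3"
          using that by (auto simp: G_def)
        then show ?thesis using \<delta> by argo
      qed
      ultimately show ?thesis by (intro exI[of _ G] conjI ballI)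
    next
      case False
      \<comment> \<open>Over a point outside the range of the projection the empty set serves as
        neighborhood of the empty fiber.\<close>
      then have "proj \<beta> -` {z} \<subseteq> {}" by auto
      then show ?thesis by (intro exI[of _ "{}"]) auto
    qed
    then obtain G where G: "open G" "proj \<beta> -` {z} \<subseteq> G"
      "\<forall>x\<in>G. \<forall>x'\<in>G. \<bar>apply_bcontfun f x - apply_bcontfun f x'\<bar> < \<delta>" by blast
    from tube[OF \<beta>(2) z G(1,2)] show ?thesis using G(3) by (fastforce simp: small_def)
  qed
  have local: "\<exists>V. openin (Y \<alpha>) V \<and> y \<in> V \<and> ?bad \<inter> V \<subseteq> {y}" if y: "y \<in> topspace (Y \<alpha>)" for y
  proof -
    have full: "fully_closed_map (Y \<beta>) (Y \<alpha>) (\<pi> \<alpha> \<beta>)"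
      using F_decomposable \<beta> by (auto simp: F_decomposable_def)
    define S where "S = fiber (Y \<beta>) (\<pi> \<alpha> \<beta>) y"
    have "closedin (Y \<beta>) S"
      unfolding S_def fiber_def
      using full y system(4)[OF \<alpha>] by (intro closedin_continuous_maps_eq[of "Y \<alpha>"]) (auto simp: fully_closed_map_def)
    then have S: "compactin (Y \<beta>) S" using system(3)[OF \<beta>(2)] by (rule closedin_compact_space[rotated])
    define \<U> where "\<U> = {U. openin (Y \<beta>) U \<and> small U}"
    have "S \<subseteq> \<Union>\<U>" using small_nhd by (auto simp: S_def fiber_def \<U>_def)
    moreover have "\<forall>U\<in>\<U>. openin (Y \<beta>) U" by (simp add: \<U>_def)
    ultimately obtain \<F> where \<F>: "finite \<F>" "\<F> \<subseteq> \<U>" "S \<subseteq> \<Union>\<F>"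
      using S unfolding compactin_def by metis
    then have "finite \<F> \<and> (\<forall>U\<in>\<F>. openin (Y \<beta>) U) \<and> fiber (Y \<beta>) (\<pi> \<alpha> \<beta>) y \<subseteq> \<Union>\<F>"
      by (auto simp: \<U>_def S_def)
    moreover have "fully_closed_at (Y \<beta>) (Y \<alpha>) (\<pi> \<alpha> \<beta>) y"
      using full y by (simp add: fully_closed_map_def)
    ultimately have "\<exists>V. openin (Y \<alpha>) V \<and> y \<in> V \<and> V \<subseteq> {y} \<union> (\<Union>U\<in>\<F>. small_image (Y \<beta>) (Y \<alpha>) (\<pi> \<alpha> \<beta>) U)"
      unfolding fully_closed_at_def by simp
    then obtain V where V: "openin (Y \<alpha>) V" "y \<in> V"
      "V \<subseteq> {y} \<union> (\<Union>U\<in>\<F>. small_image (Y \<beta>) (Y \<alpha>) (\<pi> \<alpha> \<beta>) U)"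
      by blast
    \<comment> \<open>A point \<open>t\<close> of \<open>V\<close> other than \<open>y\<close> lies
      in the small image of a single \<open>U\<close> of the cover: the whole fiber over
      \<open>t\<close> is inside \<open>U\<close>, where \<open>f\<close> varies by less than
      \<delta>.\<close>
    have "t = y" if t: "t \<in> ?bad" "t \<in> V" for t
    proof (rule ccontr)
      assume "t \<noteq> y"
      then obtain U where U: "U \<in> \<F>" "t \<in> small_image (Y \<beta>) (Y \<alpha>) (\<pi> \<alpha> \<beta>) U" using V(3) t(2) by auto
      have in_U: "proj \<beta> x \<in> U" if "proj \<alpha> x = t" for x
        using U(2) that bond[OF \<beta>, of x] proj_in[OF \<beta>(2), of x] by (force simp: small_image_def)
      obtain x x' where "proj \<alpha> x = t" "proj \<alpha> x' = t" "\<delta> \<le> \<bar>apply_bcontfun f x - apply_bcontfun f x'\<bar>"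
        using t(1) by blast
      moreover have "small U" using U(1) \<F>(2) by (auto simp: \<U>_def)
      ultimately show False unfolding small_def using in_U by (metis not_less)
    qed
    then show ?thesis using V(1,2) by blast
  qed
  have "compactin (Y \<alpha>) (topspace (Y \<alpha>))" using system(3)[OF \<alpha>] by (simp add: compact_space_def)
  moreover have "?bad \<subseteq> topspace (Y \<alpha>)" using proj_in[OF \<alpha>] by auto
  ultimately show ?thesis using local by (rule finite_if_locally_subsingleton)
qed

section \<open>Correcting a function over finitely many fibers\<close>

text \<open>Over a single point of \<open>A\<close> the projection to level \<beta> maps into one
  metrizable fiber. The finitely many preimages are disjoint and closed, so bumps extended by 0 to
  the other preimages stay continuous.\<close>

lemma ex_countable_bumps_fibers:
  assumes succ: "succ_ordinal \<alpha> \<beta>" and \<beta>: "\<beta> < \<gamma>" and A: "finite A" "A \<subseteq> range (proj \<alpha>)"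
  shows "\<exists>\<Phi>. bump_family (proj \<alpha> -` A) (proj \<beta>) \<Phi>"
proof -
  have \<alpha>: "\<alpha> \<le> \<beta>" "\<alpha> < \<gamma>" using succ \<beta> by (auto simp: succ_ordinal_def)
  have "\<exists>\<Phi>. bump_family (proj \<alpha> -` {t}) (proj \<beta>) \<Phi>" if t: "t \<in> A" for t
  proof (rule ex_countable_bumps)
    show "compact (proj \<alpha> -` {t})"
      using compact_Int_closed[OF compact closed_fiber[OF \<alpha>(2)]] by simp
    have "t \<in> topspace (Y \<alpha>)" using t A proj_in[OF \<alpha>(2)] by auto
    then show "metrizable_space (subtopology (Y \<beta>) (fiber (Y \<beta>) (\<pi> \<alpha> \<beta>) t))"
      using metrizable_fibers succ \<beta> by (auto simp: metrizable_neighboring_fibers_def)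
    show "continuous_map (top_of_set (proj \<alpha> -` {t})) (subtopology (Y \<beta>) (fiber (Y \<beta>) (\<pi> \<alpha> \<beta>) t)) (proj \<beta>)"
      using continuous_proj[OF \<beta>] proj_in[OF \<beta>] bond[OF \<alpha>(1) \<beta>]
      by (auto simp: continuous_map_in_subtopology fiber_def intro: continuous_map_from_subtopology)
  qed
  then obtain \<Psi> where "\<And>t. t \<in> A \<Longrightarrow> bump_family (proj \<alpha> -` {t}) (proj \<beta>) (\<Psi> t)"
    by metis
  note \<Psi> = bump_familyD[OF this]
  define ext where "ext = (\<lambda>t \<phi> x. if proj \<alpha> x = t then \<phi> x else (0::real))"
  define \<Phi> where "\<Phi> = (\<Union>t\<in>A. ext t ` \<Psi> t)"
  have "countable \<Phi>" using A(1) \<Psi>(1) by (auto simp: \<Phi>_def intro: countable_finite)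
  moreover have "continuous_on (proj \<alpha> -` A) \<phi>" if \<phi>: "\<phi> \<in> \<Phi>" for \<phi>
  proof -
    obtain t \<psi> where t: "t \<in> A" "\<psi> \<in> \<Psi> t" "\<phi> = ext t \<psi>" using \<phi> by (auto simp: \<Phi>_def)
    have "continuous_on (proj \<alpha> -` {s}) \<phi>" for s
    proof (cases "s = t")
      case True
      have "continuous_on (proj \<alpha> -` {t}) \<psi>" using \<Psi>(2) t by blast
      then show ?thesis
        unfolding True by (rule continuous_on_eq) (simp add: t(3) ext_def)
    next
      case False
      have "continuous_on (proj \<alpha> -` {s}) (\<lambda>_. 0 :: real)" by simp
      then show ?thesis
        by (rule continuous_on_eq) (use False in \<open>auto simp: t(3) ext_def\<close>)
    qed
    then have "continuous_on (\<Union>s\<in>A. proj \<alpha> -` {s}) \<phi>"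
      using A(1) closed_fiber[OF \<alpha>(2)] by (intro continuous_on_closed_Union)
    moreover have "(\<Union>s\<in>A. proj \<alpha> -` {s}) = proj \<alpha> -` A" by auto
    ultimately show ?thesis by simp
  qed
  moreover have "0 \<le> \<phi> x" if "\<phi> \<in> \<Phi>" for \<phi> x
    using that \<Psi>(3) by (auto simp: \<Phi>_def ext_def)
  moreover have "\<exists>\<phi>\<in>\<Phi>. 0 < \<phi> x0 \<and> (\<forall>x\<in>proj \<alpha> -` A. 0 < \<phi> x \<longrightarrow> x \<in> G)"
    if x0: "x0 \<in> proj \<alpha> -` A" and G: "open G" "\<And>x. x \<in> proj \<alpha> -` A \<Longrightarrow> proj \<beta> x = proj \<beta> x0 \<Longrightarrow> x \<in> G" for x0 G
  proof -
    have "\<exists>\<phi>\<in>\<Psi> (proj \<alpha> x0). 0 < \<phi> x0 \<and> (\<forall>x\<in>proj \<alpha> -` {proj \<alpha> x0}. 0 < \<phi> x \<longrightarrow> x \<in> G)"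
      using x0 G by (intro \<Psi>(4)) auto
    then obtain \<phi> where \<phi>: "\<phi> \<in> \<Psi> (proj \<alpha> x0)" "0 < \<phi> x0" "\<forall>x\<in>proj \<alpha> -` {proj \<alpha> x0}. 0 < \<phi> x \<longrightarrow> x \<in> G"
      by blast
    then show ?thesis
      using x0 by (intro bexI[of _ "ext (proj \<alpha> x0) \<phi>"]) (auto simp: ext_def \<Phi>_def)
  qed
  ultimately have "bump_family (proj \<alpha> -` A) (proj \<beta>) \<Phi>" by (rule bump_familyI)
  then show ?thesis ..
qed

text \<open>\<open>v\<close> is multiplied by a Urysohn function of level \<alpha> that is 1 on
  \<open>A\<close> and 0 at the finitely many other points over which \<open>v\<close> oscillates by
  at least \<eta>. The factor is constant on fibers of level \<alpha> and at most 1, so it never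
  enlarges an oscillation.\<close>

lemma ex_cutoff:
  fixes v :: "'x \<Rightarrow>\<^sub>C real"
  assumes \<alpha>: "\<alpha> < \<gamma>" and A: "finite A" "A \<subseteq> range (proj \<alpha>)" and \<eta>: "0 < \<eta>"
  shows "\<exists>u :: 'x \<Rightarrow>\<^sub>C real. (\<forall>x\<in>proj \<alpha> -` A. apply_bcontfun u x = apply_bcontfun v x) \<and>
    (\<forall>x y. proj \<alpha> x = proj \<alpha> y \<longrightarrow> proj \<alpha> x \<notin> A \<longrightarrow> \<bar>apply_bcontfun u x - apply_bcontfun u y\<bar> \<le> \<eta>)"
proof -
  define B where "B = {t. \<exists>x y. proj \<alpha> x = t \<and> proj \<alpha> y = t \<and> \<eta> \<le> \<bar>apply_bcontfun v x - apply_bcontfun v y\<bar>} - A"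
  have B: "finite B" "B \<subseteq> topspace (Y \<alpha>)"
    using finite_large_osc[OF \<alpha> \<eta>, of v] proj_in[OF \<alpha>] by (auto simp: B_def)
  have A': "A \<subseteq> topspace (Y \<alpha>)" using A proj_in[OF \<alpha>] by auto
  have "normal_space (Y \<alpha>)"
    using system(3,4)[OF \<alpha>] by (intro compact_Hausdorff_or_regular_imp_normal_space) auto
  moreover have "closedin (Y \<alpha>) A" "closedin (Y \<alpha>) B"
    using A(1) A' B Hausdorff_imp_t1_space[OF system(4)[OF \<alpha>]] by (auto simp: t1_space_closedin_finite)
  ultimately obtain c where c: "continuous_map (Y \<alpha>) (top_of_set {0..1::real}) c" "c ` B \<subseteq> {0}" "c ` A \<subseteq> {1}"
    using Urysohn_lemma[of "Y \<alpha>" B A 0 1] by (auto simp: B_def disjnt_def)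
  have c01: "0 \<le> c (proj \<alpha> x)" "c (proj \<alpha> x) \<le> 1" for x
    using c(1) proj_in[OF \<alpha>, of x] by (auto simp: continuous_map_in_subtopology)
  have "continuous_map euclidean euclideanreal (c \<circ> proj \<alpha>)"
    using c(1) by (intro continuous_map_compose[OF continuous_proj[OF \<alpha>]]) (simp add: continuous_map_in_subtopology)
  then have "continuous_on UNIV (\<lambda>x. c (proj \<alpha> x))" by (simp add: comp_def)
  then have "continuous_on UNIV (\<lambda>x. c (proj \<alpha> x) * apply_bcontfun v x)" by (intro continuous_intros) auto
  then obtain u where u: "apply_bcontfun u = (\<lambda>x. c (proj \<alpha> x) * apply_bcontfun v x)"
    using ex_bcontfun[OF compact] by blast
  have "\<bar>apply_bcontfun u x - apply_bcontfun u y\<bar> \<le> \<eta>" if xy: "proj \<alpha> x = proj \<alpha> y" "proj \<alpha> x \<notin> A" for x y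
  proof -
    have eq: "\<bar>apply_bcontfun u x - apply_bcontfun u y\<bar> = c (proj \<alpha> x) * \<bar>apply_bcontfun v x - apply_bcontfun v y\<bar>"
      using c01(1)[of x] xy(1) by (simp add: u abs_mult flip: right_diff_distrib)
    show ?thesis
    proof (cases "proj \<alpha> x \<in> B")
      case True
      then have "c (proj \<alpha> x) = 0" using c(2) by auto
      then show ?thesis using eq \<eta> by simp
    next
      case False
      then have "\<bar>apply_bcontfun v x - apply_bcontfun v y\<bar> < \<eta>"
        using xy by (force simp: B_def not_le)
      moreover have "c (proj \<alpha> x) * \<bar>apply_bcontfun v x - apply_bcontfun v y\<bar> \<le> 1 * \<bar>apply_bcontfun v x - apply_bcontfun v y\<bar>"
        using c01[of x] by (intro mult_right_mono) auto
      ultimately show ?thesis using eq by simp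
    qed
  qed
  moreover have "apply_bcontfun u x = apply_bcontfun v x" if "x \<in> proj \<alpha> -` A" for x
    using that c(3) by (auto simp: u)
  ultimately show ?thesis by blast
qed

text \<open>
  Here the metrizability of the fibers enters: large oscillations over the points of \<open>A\<close> are
  repaired by countably many functions on the fibers, extended to the whole space and cut off near
  the finitely many other points over which the extension oscillates.
\<close>

lemma ex_countable_correctors:
  assumes succ: "succ_ordinal \<alpha> \<beta>" and \<beta>: "\<beta> < \<gamma>" and A: "finite A" "A \<subseteq> range (proj \<alpha>)"
  shows "\<exists>U. countable U \<and> (\<forall>g\<in>small_osc \<epsilon> \<beta>. \<forall>\<theta><\<epsilon>.
    (\<forall>x y. proj \<alpha> x = proj \<alpha> y \<longrightarrow> proj \<alpha> x \<notin> A \<longrightarrow> \<bar>apply_bcontfun g x - apply_bcontfun g y\<bar> \<le> \<theta>) \<longrightarrow>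
    (\<exists>u\<in>U. g - u \<in> small_osc \<epsilon> \<alpha>))"
proof -
  have \<alpha>: "\<alpha> \<le> \<beta>" "\<alpha> < \<gamma>" using succ \<beta> by (auto simp: succ_ordinal_def)
  let ?D = "proj \<alpha> -` A"
  have "(\<Union>s\<in>A. proj \<alpha> -` {s}) = ?D" by auto
  then have D: "closed ?D" using closed_UN[OF A(1), of "\<lambda>s. proj \<alpha> -` {s}"] closed_fiber[OF \<alpha>(2)] by simp
  have fib: "closed {x \<in> ?D. proj \<beta> x = proj \<beta> x0}" if "x0 \<in> ?D" for x0
  proof -
    have "{x \<in> ?D. proj \<beta> x = proj \<beta> x0} = proj \<beta> -` {proj \<beta> x0}"
      using that by (auto dest: proj_mono[OF \<alpha>(1) \<beta>])
    then show ?thesis using closed_fiber[OF \<beta>] by simp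
  qed
  obtain \<Phi> where "bump_family ?D (proj \<beta>) \<Phi>"
    using ex_countable_bumps_fibers[OF succ \<beta> A] by blast
  from ex_countable_approximants[OF compact Hausdorff D fib this]
  obtain V where V: "countable V" and V': "\<forall>(g :: 'x \<Rightarrow>\<^sub>C real) \<epsilon>.
    (\<forall>x\<in>?D. \<forall>y\<in>?D. proj \<beta> x = proj \<beta> y \<longrightarrow> \<bar>apply_bcontfun g x - apply_bcontfun g y\<bar> < \<epsilon>) \<longrightarrow>
    (\<exists>v\<in>V. \<forall>x\<in>?D. \<bar>apply_bcontfun g x - apply_bcontfun v x\<bar> < \<epsilon> / 2)"
    by blast
  \<comment> \<open>All tolerances \<open>1 / (n + 1)\<close> are prepared, because the gap
    \<open>\<epsilon> - \<theta>\<close> into which the cutoff must fit depends on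
    \<open>g\<close>.\<close>
  have "\<forall>v :: 'x \<Rightarrow>\<^sub>C real. \<forall>n::nat. \<exists>u :: 'x \<Rightarrow>\<^sub>C real. (\<forall>x\<in>?D. apply_bcontfun u x = apply_bcontfun v x) \<and>
    (\<forall>x y. proj \<alpha> x = proj \<alpha> y \<longrightarrow> proj \<alpha> x \<notin> A \<longrightarrow> \<bar>apply_bcontfun u x - apply_bcontfun u y\<bar> \<le> 1 / (real n + 1))"
    using ex_cutoff[OF \<alpha>(2) A] by simp
  then obtain u where u: "\<And>v (n::nat) x. x \<in> ?D \<Longrightarrow> apply_bcontfun (u v n) x = apply_bcontfun v x"
    "\<And>v (n::nat) x y. proj \<alpha> x = proj \<alpha> y \<Longrightarrow> proj \<alpha> x \<notin> A \<Longrightarrow>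
      \<bar>apply_bcontfun (u v n) x - apply_bcontfun (u v n) y\<bar> \<le> 1 / (real n + 1)"
    by metis
  define U where "U = (\<Union>v\<in>V. range (u v))"
  have "countable U" using V by (auto simp: U_def)
  moreover have "\<exists>w\<in>U. g - w \<in> small_osc \<epsilon> \<alpha>"
    if g: "g \<in> small_osc \<epsilon> \<beta>" and \<theta>: "\<theta> < \<epsilon>"
      and le: "\<And>x y. proj \<alpha> x = proj \<alpha> y \<Longrightarrow> proj \<alpha> x \<notin> A \<Longrightarrow> \<bar>apply_bcontfun g x - apply_bcontfun g y\<bar> \<le> \<theta>" for g \<theta>
  proof -
    have "\<forall>x\<in>?D. \<forall>y\<in>?D. proj \<beta> x = proj \<beta> y \<longrightarrow> \<bar>apply_bcontfun g x - apply_bcontfun g y\<bar> < \<epsilon>"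
      using small_osc_D[OF g] by blast
    with V' obtain v where v: "v \<in> V" "\<And>x. x \<in> ?D \<Longrightarrow> \<bar>apply_bcontfun g x - apply_bcontfun v x\<bar> < \<epsilon> / 2"
      by meson
    obtain n where n: "1 / (real n + 1) < \<epsilon> - \<theta>"
      using reals_Archimedean[of "\<epsilon> - \<theta>"] \<theta> by (auto simp: inverse_eq_divide add.commute)
    have "\<bar>apply_bcontfun (g - u v n) x - apply_bcontfun (g - u v n) y\<bar> < \<epsilon>" if xy: "proj \<alpha> x = proj \<alpha> y" for x y
    proof (cases "proj \<alpha> x \<in> A")
      case True
      then have "x \<in> ?D" "y \<in> ?D" using xy by auto
      then have "\<bar>apply_bcontfun g x - apply_bcontfun (u v n) x\<bar> < \<epsilon> / 2"
        "\<bar>apply_bcontfun g y - apply_bcontfun (u v n) y\<bar> < \<epsilon> / 2"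
        using v(2) u(1) by auto
      then show ?thesis unfolding minus_bcontfun.rep_eq by argo
    next
      case False
      show ?thesis using le[OF xy False] u(2)[OF xy False, of v n] n unfolding minus_bcontfun.rep_eq by argo
    qed
    then have "g - u v n \<in> small_osc \<epsilon> \<alpha>" by (simp add: small_osc_def)
    then show ?thesis using v(1) by (auto simp: U_def)
  qed
  ultimately show ?thesis by (intro exI[of _ U]) blast
qed

section \<open>Transfinite induction on the level\<close>

text \<open>The squared distance to a rational constant has defect at least
  \<open>(b - a)^2 / 4\<close>, where \<open>a\<close> and \<open>b\<close> are the distances of
  \<open>f\<close> and \<open>g\<close> to it. A small defect thus gives
  \<open>norm (f - g) \<le> a + b\<close> with \<open>b\<close> close to \<open>a\<close> or
  smaller, and \<open>a \<le> 2 * \<epsilon>\<close>; this is the origin of the factor 4.\<close>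

lemma LUR_within_small_osc_zero:
  assumes \<alpha>: "zero_ordinal \<alpha>" "\<alpha> < \<gamma>" and \<epsilon>: "0 < \<epsilon>"
  shows "LUR_within (4 * \<epsilon>) (small_osc \<epsilon> \<alpha>)"
proof (rule LUR_withinI)
  define G where "G = (\<lambda>c f. (norm (f - (const_bcontfun c :: 'x \<Rightarrow>\<^sub>C real)))\<^sup>2)"
  show "countable (G ` \<rat>)" using countable_rat by blast
  show "admissible H" if "H \<in> G ` \<rat>" for H
    using that by (auto simp: G_def intro: admissible_diff[OF admissible_norm_power2])
  fix f fs \<eta> assume f: "f \<in> small_osc \<epsilon> \<alpha>" and \<eta>: "4 * \<epsilon> < \<eta>"
    and lim: "\<And>H. H \<in> G ` \<rat> \<Longrightarrow> (\<lambda>n. convexity_defect H f (fs n)) \<longlonglongrightarrow> 0"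
  obtain x0 :: 'x where True by simp
  obtain c where c: "c \<in> \<rat>" "f x0 - \<epsilon> < c" "c < f x0 + \<epsilon>"
    using Rats_dense_in_real[of "f x0 - \<epsilon>" "f x0 + \<epsilon>"] \<epsilon> by auto
  define u :: "'x \<Rightarrow>\<^sub>C real" where "u = const_bcontfun c"
  have norm_f: "norm (f - u) \<le> 2 * \<epsilon>"
  proof (rule norm_bound)
    fix x
    have "\<bar>apply_bcontfun f x - apply_bcontfun f x0\<bar> < \<epsilon>" using small_osc_D[OF f proj_zero[OF \<alpha>]] .
    then show "norm (apply_bcontfun (f - u) x) \<le> 2 * \<epsilon>"
      using c by (simp add: u_def const_bcontfun.rep_eq)
  qed
  have near: "norm (f - g) < \<eta>" if "convexity_defect (G c) f g < (\<eta> - 4 * \<epsilon>)\<^sup>2 / 4" for g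
  proof -
    define a b where "a = norm (f - u)" and "b = norm (g - u)"
    have "(1/2) *\<^sub>R (f + g) - u = (1/2) *\<^sub>R ((f - u) + (g - u))"
      using scaleR_half_double[of u] by (simp add: algebra_simps)
    then have "norm ((1/2) *\<^sub>R (f + g) - u) \<le> (a + b) / 2"
      using norm_triangle_ineq[of "f - u" "g - u"] by (simp add: a_def b_def)
    then have "(norm ((1/2) *\<^sub>R (f + g) - u))\<^sup>2 \<le> ((a + b) / 2)\<^sup>2"
      by (intro power_mono) auto
    moreover have "convexity_defect (G c) f g = (a\<^sup>2 + b\<^sup>2) / 2 - (norm ((1/2) *\<^sub>R (f + g) - u))\<^sup>2"
      by (simp add: convexity_defect_def G_def a_def b_def u_def)
    moreover have "(a\<^sup>2 + b\<^sup>2) / 2 - ((a + b) / 2)\<^sup>2 = (b - a)\<^sup>2 / 4"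
      by (simp add: power2_eq_square field_simps)
    ultimately have "(b - a)\<^sup>2 < (\<eta> - 4 * \<epsilon>)\<^sup>2" using that by linarith
    then have "b - a < \<eta> - 4 * \<epsilon>"
      by (rule power2_less_imp_less) (use \<eta> in simp)
    moreover have "norm (f - g) \<le> a + b"
      using norm_triangle_ineq4[of "f - u" "g - u"] by (simp add: a_def b_def)
    ultimately show ?thesis using norm_f by (simp add: a_def)
  qed
  have "0 < (\<eta> - 4 * \<epsilon>)\<^sup>2 / 4" using \<eta> by simp
  then have "\<forall>\<^sub>F n in sequentially. convexity_defect (G c) f (fs n) < (\<eta> - 4 * \<epsilon>)\<^sup>2 / 4"
    using lim[OF imageI[OF c(1)]] by (intro order_tendstoD)
  then show "\<forall>\<^sub>F n in sequentially. norm (f - fs n) < \<eta>"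
    by eventually_elim (rule near)
qed

text \<open>Only finitely many points carry oscillation above \<open>\<epsilon> / 2\<close>, so the
  oscillations below \<epsilon> cannot accumulate at \<epsilon>. The resulting strict gap between
  \<theta> and \<epsilon> provides both the margin of the maximizer and the room for
  cutoffs.\<close>

lemma ex_large_osc_set:
  assumes \<alpha>: "\<alpha> < \<gamma>" and \<epsilon>: "0 < \<epsilon>"
  obtains A \<theta> where "finite A" "A \<subseteq> range (proj \<alpha>)" "0 \<le> \<theta>" "\<theta> < \<epsilon>"
    "\<And>t. t \<in> A \<Longrightarrow> \<epsilon> \<le> osc (proj \<alpha> -` {t}) f"
    "\<And>t. t \<in> range (proj \<alpha>) \<Longrightarrow> t \<notin> A \<Longrightarrow> osc (proj \<alpha> -` {t}) f \<le> \<theta>"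
proof -
  define o' where "o' = (\<lambda>t. osc (proj \<alpha> -` {t}) f)"
  define B where "B = {t. \<exists>x y. proj \<alpha> x = t \<and> proj \<alpha> y = t \<and> \<epsilon> / 2 \<le> \<bar>apply_bcontfun f x - apply_bcontfun f y\<bar>}"
  define A where "A = {t \<in> range (proj \<alpha>). \<epsilon> \<le> o' t}"
  have B: "finite B" "B \<subseteq> range (proj \<alpha>)"
    using finite_large_osc[OF \<alpha>, of "\<epsilon> / 2" f] \<epsilon> by (auto simp: B_def)
  have small: "o' t \<le> \<epsilon> / 2" if "t \<in> range (proj \<alpha>)" "t \<notin> B" for t
    unfolding o'_def
  proof (rule osc_le)
    show "proj \<alpha> -` {t} \<noteq> {}" using that(1) by auto
    fix x y assume "x \<in> proj \<alpha> -` {t}" "y \<in> proj \<alpha> -` {t}"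
    then show "\<bar>apply_bcontfun f x - apply_bcontfun f y\<bar> \<le> \<epsilon> / 2"
      using that(2) by (force simp: B_def)
  qed
  then have "A \<subseteq> B" using \<epsilon> by (force simp: A_def)
  define \<theta> where "\<theta> = Max (insert (\<epsilon> / 2) (o' ` (B - A)))"
  have fin: "finite (insert (\<epsilon> / 2) (o' ` (B - A)))" using B(1) by simp
  show thesis
  proof
    show "finite A" using \<open>A \<subseteq> B\<close> B(1) by (rule finite_subset)
    show "A \<subseteq> range (proj \<alpha>)" by (auto simp: A_def)
    have "\<epsilon> / 2 \<le> \<theta>" unfolding \<theta>_def using fin by (intro Max_ge) auto
    then show "0 \<le> \<theta>" using \<epsilon> by linarith
    show "\<theta> < \<epsilon>"
      unfolding \<theta>_def using fin B(2) \<epsilon> by (subst Max_less_iff) (auto simp: A_def)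
    show "\<epsilon> \<le> osc (proj \<alpha> -` {t}) f" if "t \<in> A" for t using that by (simp add: A_def o'_def)
    show "osc (proj \<alpha> -` {t}) f \<le> \<theta>" if "t \<in> range (proj \<alpha>)" "t \<notin> A" for t
    proof (cases "t \<in> B")
      case True
      then have "o' t \<le> \<theta>" unfolding \<theta>_def using fin that by (intro Max_ge) auto
      then show ?thesis by (simp add: o'_def)
    next
      case False
      then show ?thesis using small[OF that(1)] \<open>\<epsilon> / 2 \<le> \<theta>\<close> by (simp add: o'_def)
    qed
  qed
qed

text \<open>
  For \<open>f\<close> in \<open>small_osc \<epsilon> \<beta>\<close> let \<open>A\<close> be the finite set of points of level \<open>\<alpha>\<close> over which \<open>f\<close>
  oscillates by at least \<open>\<epsilon>\<close>. Among all sets of at most \<open>card A\<close> points, \<open>A\<close> is the unique maximizer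
  of the total oscillation of \<open>f\<close>, with a margin. Hence a supremum over such sets, perturbed by
  the functions of level \<open>\<alpha>\<close> evaluated at corrections depending on the set, controls these functions
  at the correction of \<open>f\<close> that belongs to \<open>A\<close>.
\<close>

lemma LUR_within_small_osc_succ:
  assumes succ: "succ_ordinal \<alpha> \<beta>" and \<beta>: "\<beta> < \<gamma>" and \<epsilon>: "0 < \<epsilon>"
    and LUR: "LUR_within K (small_osc \<epsilon> \<alpha>)"
  shows "LUR_within K (small_osc \<epsilon> \<beta>)"
proof -
  have \<alpha>: "\<alpha> < \<gamma>" using succ \<beta> by (auto simp: succ_ordinal_def)
  obtain \<G> where \<G>: "countable \<G>" "\<And>G. G \<in> \<G> \<Longrightarrow> admissible G"
    and IH: "\<And>f fs \<eta>. \<lbrakk>f \<in> small_osc \<epsilon> \<alpha>; bounded (range fs);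
      \<And>G. G \<in> \<G> \<Longrightarrow> (\<lambda>n. convexity_defect G f (fs n)) \<longlonglongrightarrow> 0; K < \<eta>\<rbrakk>
      \<Longrightarrow> \<forall>\<^sub>F n in sequentially. norm (f - fs n) < \<eta>"
    using LUR by (rule LUR_withinE) blast
  define \<I> where "\<I> = (\<lambda>k. {A. finite A \<and> A \<subseteq> range (proj \<alpha>) \<and> card A \<le> k})"
  define corrects where "corrects = (\<lambda>A U. countable U \<and> (\<forall>g\<in>small_osc \<epsilon> \<beta>. \<forall>\<theta><\<epsilon>.
    (\<forall>x y. proj \<alpha> x = proj \<alpha> y \<longrightarrow> proj \<alpha> x \<notin> A \<longrightarrow> \<bar>apply_bcontfun g x - apply_bcontfun g y\<bar> \<le> \<theta>) \<longrightarrow>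
    (\<exists>u\<in>U. g - u \<in> small_osc \<epsilon> \<alpha>)))"
  have "\<exists>U. corrects A U" if "finite A" "A \<subseteq> range (proj \<alpha>)" for A
    unfolding corrects_def using succ \<beta> that by (rule ex_countable_correctors)
  then obtain U where corrects_U: "\<And>A. finite A \<Longrightarrow> A \<subseteq> range (proj \<alpha>) \<Longrightarrow> corrects A (U A)"
    by metis
  have U: "countable (U A)" if "finite A" "A \<subseteq> range (proj \<alpha>)" for A
    using corrects_U[OF that] by (simp add: corrects_def)
  have corrector: "\<exists>u\<in>U A. g - u \<in> small_osc \<epsilon> \<alpha>"
    if "finite A" "A \<subseteq> range (proj \<alpha>)" "g \<in> small_osc \<epsilon> \<beta>" "\<theta> < \<epsilon>"
      "\<forall>x y. proj \<alpha> x = proj \<alpha> y \<longrightarrow> proj \<alpha> x \<notin> A \<longrightarrow> \<bar>apply_bcontfun g x - apply_bcontfun g y\<bar> \<le> \<theta>" for A g \<theta>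
    using corrects_U[OF that(1,2)] that(3-5) unfolding corrects_def by simp
  define e where "e = (\<lambda>A. from_nat_into (insert 0 (U A)))"
  \<comment> \<open>Truncation at norm \<open>b\<close> makes the correctors bounded uniformly in
    \<open>A\<close>, without which the supremum over \<open>A\<close> could be infinite.\<close>
  define u where "u = (\<lambda>A j b. if norm (e A j) \<le> real b then e A j else 0)"
  have u_le: "norm (u A j b) \<le> real b" for A j b by (simp add: u_def)
  define \<phi> where "\<phi> = (\<lambda>A f. \<Sum>t\<in>A. osc (proj \<alpha> -` {t}) f)"
  \<comment> \<open>The total oscillation selects the set \<open>A\<close>; the term with
    \<open>G\<close> is a perturbation that a large \<open>m\<close> makes too small to change the
    selection.\<close>
  define \<Theta> where "\<Theta> = (\<lambda>G j b m A f. \<phi> A f + 1 / (real m + 1) * G (f - u A j b))"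
  define S where "S = (\<lambda>G k j b m f. SUP A\<in>\<I> k. \<Theta> G j b (m::nat) A f)"
  have fiber_ne: "proj \<alpha> -` {t} \<noteq> {}" if "t \<in> range (proj \<alpha>)" for t using that by auto
  have \<phi>_adm: "admissible (\<phi> A)" if "finite A" "A \<subseteq> range (proj \<alpha>)" for A
    unfolding \<phi>_def using that fiber_ne by (intro admissible_sum admissible_osc) auto
  have \<Theta>_adm: "admissible (\<Theta> G j b m A)" if "G \<in> \<G>" "A \<in> \<I> k" for G j b m A k
    unfolding \<Theta>_def using that \<G>(2)
    by (intro admissible_add admissible_cmult admissible_diff \<phi>_adm) (auto simp: \<I>_def)
  have empty_I: "{} \<in> \<I> k" for k by (simp add: \<I>_def)
  have \<Theta>_bound: "\<exists>B. \<forall>A\<in>\<I> k. \<forall>f. norm f \<le> r \<longrightarrow> \<Theta> G j b m A f \<le> B" if G: "G \<in> \<G>" for G k j b m r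
  proof -
    obtain B where B: "\<And>f. norm f \<le> r + real b \<Longrightarrow> G f \<le> B"
      using \<G>(2)[OF G] unfolding admissible_def by metis
    have "\<Theta> G j b m A f \<le> real k * (2 * r) + 1 / (real m + 1) * B"
      if A: "A \<in> \<I> k" and f: "norm f \<le> r" for A f
    proof -
      have r: "0 \<le> r" using f norm_ge_zero[of f] by linarith
      have "osc (proj \<alpha> -` {t}) f \<le> 2 * r" if "t \<in> A" for t
      proof (rule osc_le)
        show "proj \<alpha> -` {t} \<noteq> {}" using that A fiber_ne by (auto simp: \<I>_def)
        show "\<bar>apply_bcontfun f x - apply_bcontfun f y\<bar> \<le> 2 * r" for x y
          using abs_diff_le_norm[of f x y] f by linarith
      qed
      then have "\<phi> A f \<le> real (card A) * (2 * r)"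
        unfolding \<phi>_def by (intro sum_bounded_above)
      also have "\<dots> \<le> real k * (2 * r)"
        using A r by (intro mult_right_mono) (auto simp: \<I>_def)
      moreover have "norm (f - u A j b) \<le> r + real b"
        using norm_triangle_ineq4[of f "u A j b"] u_le[of A j b] f by linarith
      then have "1 / (real m + 1) * G (f - u A j b) \<le> 1 / (real m + 1) * B"
        by (intro mult_left_mono B) auto
      ultimately show ?thesis by (simp add: \<Theta>_def)
    qed
    then show ?thesis by blast
  qed
  have S_adm: "admissible (S G k j b m)" if G: "G \<in> \<G>" for G k j b m
    unfolding S_def using \<Theta>_adm[OF G] \<Theta>_bound[OF G] empty_I[of k] by (intro admissible_SUP) auto
  show ?thesis
  proof (rule LUR_withinI)
    \<comment> \<open>The sets \<open>A\<close> no longer occur among the parameters, so the family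
      is countable although there may be uncountably many of them.\<close>
    let ?S = "(\<lambda>(G, k, j, b, m). S G k j b m) ` (\<G> \<times> UNIV)"
    show "countable ?S" using \<G>(1) by (intro countable_image countable_SIGMA) auto
    show "admissible H" if "H \<in> ?S" for H using that S_adm by auto
    fix f fs \<eta>
    assume f: "f \<in> small_osc \<epsilon> \<beta>" and fs: "bounded (range fs)" and \<eta>: "K < \<eta>"
      and lim: "\<And>H. H \<in> ?S \<Longrightarrow> (\<lambda>n. convexity_defect H f (fs n)) \<longlonglongrightarrow> 0"
    obtain A \<theta> where A: "finite A" "A \<subseteq> range (proj \<alpha>)" and \<theta>: "0 \<le> \<theta>" "\<theta> < \<epsilon>"
      and large: "\<And>t. t \<in> A \<Longrightarrow> \<epsilon> \<le> osc (proj \<alpha> -` {t}) f"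
      and small: "\<And>t. t \<in> range (proj \<alpha>) \<Longrightarrow> t \<notin> A \<Longrightarrow> osc (proj \<alpha> -` {t}) f \<le> \<theta>"
      using ex_large_osc_set[OF \<alpha> \<epsilon>, of f] by blast
    have "\<bar>apply_bcontfun f x - apply_bcontfun f y\<bar> \<le> \<theta>" if xy: "proj \<alpha> x = proj \<alpha> y" "proj \<alpha> x \<notin> A" for x y
      using abs_diff_le_osc[of x "proj \<alpha> -` {proj \<alpha> x}" y f] small[OF rangeI xy(2)] xy(1) by simp
    then have "\<exists>u\<in>U A. f - u \<in> small_osc \<epsilon> \<alpha>"
      by (intro corrector[OF A f \<theta>(2)]) simp
    then obtain w where w: "w \<in> U A" "f - w \<in> small_osc \<epsilon> \<alpha>" ..
    have "w \<in> range (e A)"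
      using w(1) U[OF A] by (simp add: e_def range_from_nat_into)
    then obtain j where j: "e A j = w" by blast
    obtain b where b: "norm w \<le> real b" using real_arch_simple by blast
    have u_eq: "u A j b = w" using j b by (simp add: u_def)
    define k where "k = card A"
    have A_I: "A \<in> \<I> k" using A by (simp add: \<I>_def k_def)
    have G_lim: "(\<lambda>n. convexity_defect G (f - w) (fs n - w)) \<longlonglongrightarrow> 0" if G: "G \<in> \<G>" for G
    proof -
      have G_adm: "admissible G" using \<G>(2)[OF G] .
      obtain B where B: "\<And>h. norm h \<le> norm f + real b \<Longrightarrow> G h \<le> B"
        using G_adm unfolding admissible_def by metis
      have "G 0 \<le> B" by (rule B) simp
      then have B_nonneg: "0 \<le> B" using G_adm order_trans unfolding admissible_def by blast
      \<comment> \<open>With this weight the perturbation uses at most half of the gap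
        \<open>\<epsilon> - \<theta>\<close> for every competing set; the other half is the margin
        \<delta>.\<close>
      obtain m :: nat where m: "2 * B / (\<epsilon> - \<theta>) \<le> real m" using real_arch_simple by blast
      have Bm: "1 / (real m + 1) * B \<le> (\<epsilon> - \<theta>) / 2"
        using m \<theta> B_nonneg by (simp add: field_simps)
      define \<delta> where "\<delta> = (\<epsilon> - \<theta>) / 2"
      have bdd: "bdd_above ((\<lambda>A. \<Theta> G j b m A h) ` \<I> k)" for h
        using \<Theta>_bound[OF G, of k "norm h" j b m] by (auto simp: bdd_above_def)
      have "\<Theta> G j b m A f \<le> S G k j b m f"
        unfolding S_def using A_I bdd by (intro cSUP_upper)
      moreover have "0 \<le> 1 / (real m + 1) * G (f - u A j b)"
        using G_adm by (simp add: admissible_def)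
      ultimately have S_ge: "\<phi> A f \<le> S G k j b m f" by (simp add: \<Theta>_def)
      have gap: "\<Theta> G j b m A' f \<le> S G k j b m f - \<delta>" if A': "A' \<in> \<I> k" "A' \<noteq> A" for A'
      proof -
        have "\<phi> A' f + (\<epsilon> - \<theta>) \<le> \<phi> A f"
          unfolding \<phi>_def using A A' \<theta> large small
          by (intro sum_add_gap_le) (auto simp: \<I>_def k_def)
        moreover have "norm (f - u A' j b) \<le> norm f + real b"
          using norm_triangle_ineq4[of f "u A' j b"] u_le[of A' j b] by linarith
        then have "1 / (real m + 1) * G (f - u A' j b) \<le> 1 / (real m + 1) * B"
          by (intro mult_left_mono B) auto
        ultimately show ?thesis using Bm S_ge unfolding \<Theta>_def \<delta>_def by argo
      qed
      have \<delta>: "0 < \<delta> / 2" using \<theta> by (simp add: \<delta>_def)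
      have lim_S: "(\<lambda>n. convexity_defect (S G k j b m) f (fs n)) \<longlonglongrightarrow> 0"
        by (rule lim) (use G in \<open>auto intro!: image_eqI[of _ _ "(G, k, j, b, m)"]\<close>)
      have le: "convexity_defect G (f - w) (fs n - w) \<le> (real m + 1) * convexity_defect (S G k j b m) f (fs n)"
        if n: "convexity_defect (S G k j b m) f (fs n) < \<delta> / 2" for n
      proof -
        have "convexity_defect (\<Theta> G j b m A) f (fs n) \<le> convexity_defect (S G k j b m) f (fs n)"
          unfolding S_def
        proof (rule convexity_defect_SUP[OF _ bdd A_I])
          show "convex_on UNIV (\<Theta> G j b m i)" if "i \<in> \<I> k" for i
            using \<Theta>_adm[OF G that] by (simp add: admissible_def)
        qed (use gap n in \<open>auto simp: S_def\<close>)
        moreover have "convexity_defect (\<Theta> G j b m A) f (fs n) =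
            convexity_defect (\<phi> A) f (fs n) + 1 / (real m + 1) * convexity_defect G (f - w) (fs n - w)"
          unfolding \<Theta>_def convexity_defect_add convexity_defect_cmult convexity_defect_diff u_eq ..
        moreover have "0 \<le> convexity_defect (\<phi> A) f (fs n)"
          using \<phi>_adm[OF A] by (intro convexity_defect_nonneg) (simp add: admissible_def)
        ultimately have "1 / (real m + 1) * convexity_defect G (f - w) (fs n - w)
            \<le> convexity_defect (S G k j b m) f (fs n)" by simp
        then show ?thesis by (simp add: field_simps)
      qed
      have "(\<lambda>n. (real m + 1) * convexity_defect (S G k j b m) f (fs n)) \<longlonglongrightarrow> (real m + 1) * 0"
        by (intro tendsto_mult lim_S tendsto_const)
      then have "(\<lambda>n. (real m + 1) * convexity_defect (S G k j b m) f (fs n)) \<longlonglongrightarrow> 0" by simp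
      then show ?thesis
      proof (rule tendsto_sandwich[OF _ _ tendsto_const, rotated 2])
        have "\<forall>\<^sub>F n in sequentially. convexity_defect (S G k j b m) f (fs n) < \<delta> / 2"
          using lim_S \<delta> by (rule order_tendstoD)
        then show "\<forall>\<^sub>F n in sequentially. convexity_defect G (f - w) (fs n - w)
            \<le> (real m + 1) * convexity_defect (S G k j b m) f (fs n)"
          by eventually_elim (rule le)
        show "\<forall>\<^sub>F n in sequentially. 0 \<le> convexity_defect G (f - w) (fs n - w)"
          using G_adm by (simp add: convexity_defect_nonneg admissible_def)
      qed
    qed
    have "bounded (range (\<lambda>n. fs n - w))"
      using bounded_translation_minus[OF fs, of w] by (simp add: image_image)
    \<comment> \<open>The corrector \<open>w\<close> cancels in the difference, so the error
      \<open>K\<close> is unchanged.\<close>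
    from IH[OF w(2) this G_lim \<eta>] show "\<forall>\<^sub>F n in sequentially. norm (f - fs n) < \<eta>" by simp
  qed
qed

text \<open>The error is fixed at level 0; successor steps preserve it, and at limits countable
  unions of families do as well.\<close>

lemma LUR_within_small_osc:
  assumes "0 < \<epsilon>" "\<alpha> < \<gamma>"
  shows "LUR_within (4 * \<epsilon>) (small_osc \<epsilon> \<alpha>)"
  using assms(2)
proof (induction \<alpha> rule: less_induct)
  case (less \<alpha>)
  consider "zero_ordinal \<alpha>" | \<delta> where "succ_ordinal \<delta> \<alpha>" | "limit_ordinal \<alpha>"
    unfolding limit_ordinal_def by blast
  then show ?case
  proof cases
    case 1
    then show ?thesis using less.prems assms(1) by (rule LUR_within_small_osc_zero)
  next
    case 2
    then have "\<delta> < \<alpha>" by (simp add: succ_ordinal_def)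
    then have "LUR_within (4 * \<epsilon>) (small_osc \<epsilon> \<delta>)" using less by simp
    then show ?thesis using LUR_within_small_osc_succ[OF 2 less.prems assms(1)] by blast
  next
    case 3
    have "countable {..<\<alpha>}"
      using countable_length less.prems by (elim countable_subset[rotated]) auto
    then have "LUR_within (4 * \<epsilon>) (\<Union>\<beta>\<in>{..<\<alpha>}. small_osc \<epsilon> \<beta>)"
      using less by (intro LUR_within_UN) auto
    moreover have "small_osc \<epsilon> \<alpha> \<subseteq> (\<Union>\<beta>\<in>{..<\<alpha>}. small_osc \<epsilon> \<beta>)"
      using ex_small_osc_below_limit[OF 3 less.prems] by auto
    ultimately show ?thesis by (rule LUR_within_subset)
  qed
qed

lemma LUR_within_UNIV:
  assumes "0 < \<epsilon>"
  shows "LUR_within \<epsilon> (UNIV :: ('x \<Rightarrow>\<^sub>C real) set)"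
proof -
  have "LUR_within (4 * (\<epsilon> / 4)) (\<Union>\<beta>\<in>{..<\<gamma>}. small_osc (\<epsilon> / 4) \<beta>)"
    using countable_length assms by (intro LUR_within_UN LUR_within_small_osc) auto
  moreover have "UNIV \<subseteq> (\<Union>\<beta>\<in>{..<\<gamma>}. small_osc (\<epsilon> / 4) \<beta>)"
    using ex_small_osc_index[of "\<epsilon> / 4"] assms by auto
  ultimately show ?thesis using LUR_within_subset by fastforce
qed

end

theorem theorem5p1:
  fixes \<gamma> :: "'i::wellorder"
    and X :: "'i \<Rightarrow> 'a topology"
    and \<pi> :: "'i \<Rightarrow> 'i \<Rightarrow> 'a \<Rightarrow> 'a"
  assumes "countable {..<\<gamma>}"
    and "has_spectral_height (euclidean :: 'x::topological_space topology) \<gamma>"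
    and "F_decomposable \<gamma> X \<pi>"
    and "metrizable_neighboring_fibers \<gamma> X \<pi>"
    and "(euclidean :: 'x topology) homeomorphic_space inverse_limit \<gamma> X \<pi>"
  shows "\<exists>N :: ('x \<Rightarrow>\<^sub>C real) \<Rightarrow> real.
    equivalent_norm N \<and> LUR_norm N \<and> lower_semicontinuous_map pointwise_topology N"
proof -
  obtain h where "homeomorphic_map (euclidean :: 'x topology) (inverse_limit \<gamma> X \<pi>) h"
    using assms(5) homeomorphic_space by blast
  then interpret F_decomposable_limit \<gamma> X \<pi> h
    using assms by unfold_locales
  show ?thesis by (rule ex_LUR_norm_if_LUR_within) (rule LUR_within_UNIV)
qed

end
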